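(* Let $n\ge1$, let $\lambda\in(0,1)$ and let $f,g:\mathbb{R}^n\to\mathbb{R}_{\geq0}$ be non-negative measurable functions such that $(1-\lambda) f\star\lambda g$ is measurable. If there exists a hyperplane $H\in\mathcal{L}^n_{n-1}$ such that $$(1-\lambda)\overline{S_H(f)}\star\lambda\overline{S_H(g)}\quad\text{and}\quad (1-\lambda)S_{H^\perp}\bigl(\overline{S_H(f)}\bigr)\star\lambda S_{H^\perp}\bigl(\overline{S_H(g)}\bigr)$$ are measurable functions and $$\int_H \mathrm{proj}_H(f)(x)\,\mathrm{d} x=\int_H \mathrm{proj}_H(g)(x)\,\mathrm{d} x<\infty,$$ then $$\int_{\mathbb{R}^n}(1-\lambda) f\star\lambda g\,\mathrm{d} x \;\geq\;(1-\lambda)\int_{\mathbb{R}^n}f\,\mathrm{d} x+\lambda\int_{\mathbb{R}^n}g\,\mathrm{d} x.$$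
   Context: Measurable means Lebesgue measurable; $\mathrm{vol}_k$ is $k$-dimensional Lebesgue measure; integrals of non-negative functions take values in $[0,\infty]$. $\mathcal{L}^n_{n-1}$ is the set of $(n-1)$-dimensional linear subspaces of $\mathbb{R}^n$; $A|H$ is the orthogonal projection of $A$ onto $H$. Asplund sum: $\bigl((1-\lambda) f\star\lambda g\bigr)(x)=\sup_{(1-\lambda) x_1+\lambda x_2=x} f(x_1)^{1-\lambda} g(x_2)^{\lambda}$ for $f,g:\mathbb{R}^n\to\mathbb{R}_{\ge0}$. Projection: for $f:\mathbb{R}^n\to\mathbb{R}_{\ge0}\cup\{\infty\}$ and $H$ with unit normal $\nu$, $\mathrm{proj}_H(f)(h)=\sup_{\alpha\in\mathbb{R}} f(h+\alpha\nu)$, $h\in H$. For an extended function $f:\mathbb{R}^n\to\mathbb{R}_{\ge0}\cup\{\infty\}$, $\overline f:\mathbb{R}^n\to\mathbb{R}_{\ge0}$ is $\overline f(x)=0$ if $f(x)=\infty$ and $\overline f(x)=f(x)$ otherwise. Steiner symmetral of a set: for a nonempty measurable $A\subset\mathbb{R}^n$, $$S_H(A)=\{h+l:\ h\in A|H,\ l\in H^\perp,\ |l|\le \tfrac12\mathrm{vol}_1(A\cap(h+H^\perp))\},$$ and $S_H(\emptyset)=\emptyset$ (for the null set of $h$ where the section is not measurable, $\mathrm{vol}_1$ is read as outer measure). Steiner symmetral of a function: for measurable $f:\mathbb{R}^n\to\mathbb{R}_{\ge0}\cup\{\infty\}$ write $f=e^{-u}$ with $u=-\log f$ ($\log 0=-\infty$,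 $\log\infty=\infty$), let $\mathrm{epi}_s(u)=\{(x,t)\in\mathbb{R}^n\times\mathbb{R}: t>u(x)\}$, $\widetilde H=H\times\mathbb{R}$ (a hyperplane of $\mathbb{R}^{n+1}$), and $u_H(x)=\inf\{r\in\mathbb{R}:(x,r)\in S_{\widetilde H}(\mathrm{epi}_s(u))\}$ ($\inf\emptyset=\infty$). Then $S_H(f)=e^{-u_H}:\mathbb{R}^n\to\mathbb{R}_{\ge0}\cup\{\infty\}$. Schwarz-type symmetrization: for measurable $f:\mathbb{R}^n\to\mathbb{R}_{\ge0}\cup\{\infty\}$, $S_{H^\perp}(f)(h+\alpha\nu)=d_\alpha\,\chi_{B_{n-1}}(h)$ for $h\in H$, $\alpha\in\mathbb{R}$, where $\nu$ is a unit normal of $H$, $d_\alpha=\int_{\alpha\nu+H}f|_{(\alpha\nu+H)}\,\mathrm{d}x$ ($(n-1)$-dimensional Lebesgue integral; upper integral for the null set of $\alpha$ where the restriction is not measurable), $\chi$ denotes a characteristic function, $B_{n-1}\subset H$ is the Euclidean ball centred at the origin with $\mathrm{vol}_{n-1}(B_{n-1})=1$, and $\infty\cdot0=0$. *)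

theory Defs
  imports "HOL-Analysis.Analysis"
begin

text \<open>
  All functions into \<open>[0,\<infinity>]\<close> have type \<^typ>\<open>'a \<Rightarrow> ennreal\<close>; functions into \<open>[0,\<infinity>)\<close> are those
  that moreover never take the value \<open>\<infinity>\<close>.  Recall that \<open>\<infinity> * 0 = 0\<close> in \<^typ>\<open>ennreal\<close>.
\<close>

section \<open>Asplund sum\<close>

text \<open>Used for exponents \<open>0 < a < 1\<close>.  The value at \<open>\<infinity>\<close> only makes the power total.\<close>

definition ennreal_pow :: "ennreal \<Rightarrow> real \<Rightarrow> ennreal" where
  "ennreal_pow x a = (if x = \<infinity> then \<infinity> else ennreal (enn2real x powr a))"

definition asplund_sum ::
    "real \<Rightarrow> ('a::real_vector \<Rightarrow> ennreal) \<Rightarrow> ('a \<Rightarrow> ennreal) \<Rightarrow> 'a \<Rightarrow> ennreal" where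
  "asplund_sum lam f g x =
     Sup {ennreal_pow (f x1) (1 - lam) * ennreal_pow (g x2) lam | x1 x2.
            (1 - lam) *\<^sub>R x1 + lam *\<^sub>R x2 = x}"

definition finite_part :: "('a \<Rightarrow> ennreal) \<Rightarrow> 'a \<Rightarrow> ennreal" where
  "finite_part f x = (if f x = \<infinity> then 0 else f x)"

section \<open>Hyperplanes\<close>

text \<open>
  In what follows \<open>H\<close> is a linear subspace of codimension 1.  Its unit normal is determined up to
  sign only, and nothing below depends on the sign, up to the reflection \<open>\<alpha> \<mapsto> - \<alpha>\<close>.
\<close>

definition unit_normal :: "'a::euclidean_space set \<Rightarrow> 'a" where
  "unit_normal H = (SOME \<nu>. norm \<nu> = 1 \<and> (\<forall>h\<in>H. inner h \<nu> = 0))"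

definition proj_pt :: "'a::euclidean_space set \<Rightarrow> 'a \<Rightarrow> 'a" where
  "proj_pt H x = x - inner x (unit_normal H) *\<^sub>R unit_normal H"

definition proj_fun :: "'a::euclidean_space set \<Rightarrow> ('a \<Rightarrow> ennreal) \<Rightarrow> 'a \<Rightarrow> ennreal" where
  "proj_fun H f h = (SUP \<alpha>::real. f (h + \<alpha> *\<^sub>R unit_normal H))"

section \<open>Lebesgue measure on a subspace, upper integral\<close>

text \<open>
  Lebesgue measure on a linear subspace \<open>V\<close> of dimension \<open>k\<close>: the image of the \<open>k\<close>-fold product of
  one-dimensional Lebesgue measure under an orthonormal coordinate system of \<open>V\<close>, completed; compare
  the library's definition of \<^const>\<open>lborel\<close>.  For \<open>k = 0\<close> it is the unit mass at the origin.
\<close>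

definition onb_of :: "'a::euclidean_space set \<Rightarrow> 'a set" where
  "onb_of V = (SOME B. pairwise orthogonal B \<and> (\<forall>b\<in>B. norm b = 1) \<and> span B = V)"

definition lebesgue_subspace :: "'a::euclidean_space set \<Rightarrow> 'a measure" where
  "lebesgue_subspace V =
     completion (distr (\<Pi>\<^sub>M b\<in>onb_of V. (lborel :: real measure)) (restrict_space borel V)
       (\<lambda>c. \<Sum>b\<in>onb_of V. c b *\<^sub>R b))"

text \<open>
  The upper integral agrees with \<^const>\<open>nn_integral\<close> for measurable integrands.
\<close>

definition upper_integral :: "'a measure \<Rightarrow> ('a \<Rightarrow> ennreal) \<Rightarrow> ennreal" where
  "upper_integral M f =
     (INF k\<in>{k \<in> borel_measurable M. \<forall>x\<in>space M. f x \<le> k x}. \<integral>\<^sup>+ x. k x \<partial>M)"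

section \<open>Steiner symmetrization\<close>

text \<open>
  The section \<open>A \<inter> (h + H\<^sup>\<bottom>)\<close> is parametrized by arc length \<open>\<alpha> \<mapsto> h + \<alpha> \<nu>\<close>.  On measurable sections
  the outer measure is the measure.
\<close>

definition steiner_set :: "'a::euclidean_space set \<Rightarrow> 'a set \<Rightarrow> 'a set" where
  "steiner_set H A =
     {h + l | h l. h \<in> proj_pt H ` A \<and> l \<in> H\<^sup>\<bottom> \<and>
        ennreal (norm l) \<le>
          outer_measure_of lebesgue {\<alpha>::real. h + \<alpha> *\<^sub>R unit_normal H \<in> A} / 2}"

definition ln_ext :: "ennreal \<Rightarrow> ereal" where
  "ln_ext y = (if y = 0 then - \<infinity> else if y = \<infinity> then \<infinity> else ereal (ln (enn2real y)))"

definition exp_ext :: "ereal \<Rightarrow> ennreal" where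
  "exp_ext s = (if s = - \<infinity> then 0 else if s = \<infinity> then \<infinity> else ennreal (exp (real_of_ereal s)))"

definition strict_epigraph :: "('a \<Rightarrow> ereal) \<Rightarrow> ('a \<times> real) set" where
  "strict_epigraph u = {(x, t). u x < ereal t}"

definition steiner_exponent ::
    "'a::euclidean_space set \<Rightarrow> ('a \<Rightarrow> ereal) \<Rightarrow> 'a \<Rightarrow> ereal" where
  "steiner_exponent H u x =
     Inf {ereal r | r. (x, r) \<in> steiner_set (H \<times> (UNIV :: real set)) (strict_epigraph u)}"

definition steiner_fun :: "'a::euclidean_space set \<Rightarrow> ('a \<Rightarrow> ennreal) \<Rightarrow> 'a \<Rightarrow> ennreal" where
  "steiner_fun H f x = exp_ext (- steiner_exponent H (\<lambda>y. - ln_ext (f y)) x)"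

section \<open>Schwarz-type symmetrization\<close>

text \<open>
  The ball of volume 1 in \<open>H\<close>.  If \<open>dim H = 0\<close> every radius gives the ball \<open>{0}\<close>; otherwise the
  radius is unique.
\<close>

definition unit_volume_ball :: "'a::euclidean_space set \<Rightarrow> 'a set" where
  "unit_volume_ball H =
     H \<inter> cball 0 (SOME r. 0 < r \<and> emeasure (lebesgue_subspace H) (H \<inter> cball 0 r) = 1)"

definition slice_integral :: "'a::euclidean_space set \<Rightarrow> ('a \<Rightarrow> ennreal) \<Rightarrow> real \<Rightarrow> ennreal" where
  "slice_integral H f \<alpha> =
     upper_integral (lebesgue_subspace H) (\<lambda>h. f (h + \<alpha> *\<^sub>R unit_normal H))"

definition schwarz_fun :: "'a::euclidean_space set \<Rightarrow> ('a \<Rightarrow> ennreal) \<Rightarrow> 'a \<Rightarrow> ennreal" where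
  "schwarz_fun H f x =
     slice_integral H f (inner x (unit_normal H)) * indicator (unit_volume_ball H) (proj_pt H x)"

end

theory Submission
  imports Defs "HOL-Probability.Distributions" "HOL-Probability.Weak_Convergence"
begin

text \<open>
  On the lines orthogonal to \<open>H\<close> the one-dimensional Brunn--Minkowski
  inequality, applied to level sets relative to the suprema \<open>F = proj f\<close> and \<open>G = proj g\<close>, gives,
  with the line integrals \<open>P\<close> of \<open>f\<close>, \<open>Q\<close> of \<open>g\<close> and \<open>M\<close> of the Asplund sum,
  \<open>M ((1 - \<lambda>) x + \<lambda> y) \<ge> F(x) powr (1 - \<lambda>) * G(y) powr \<lambda> * ((1 - \<lambda>) P(x) / F(x) + \<lambda> Q(y) / G(y))\<close>
  for \<open>x, y \<in> H\<close>.  If \<open>F\<close> and \<open>G\<close> have equal integrals, integrating this along a monotone transport of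
  \<open>F dx\<close> to \<open>G dy\<close> yields \<open>\<integral>M \<ge> (1 - \<lambda>) \<integral>P + \<lambda> \<integral>Q\<close>; by Fubini it suffices to transport in one variable
  at a time, and in one variable the Jacobian bound is elementary.

  The functions \<open>F\<close> and \<open>G\<close> need not be measurable.  They are replaced by measurable majorants
  attaining their upper integrals, at the price that the inequality then holds only for almost every
  pair \<open>(x, y)\<close>.  The graph of the transport map is a null set, so the pairs used are shifted by a
  generic small vector, which is sent to \<open>0\<close> at the end.
\<close>

section \<open>Monotone transport on the line\<close>

text \<open>Transporting one variable at a time forces a statement with unequal masses, because
  slices of F and G need not have equal integrals even when F and G do. The suitable form is A^(1-l)
  B^l ((1-l) mean_F(p) + l mean_G(q)) \<le> integral of M, where A and B are the masses of F and G
  and the means are weighted by F and G. It has the shape of its own hypothesis: replacing F(x),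
  G(y), p(x), q(y) by masses and means over slices, one recovers the hypothesis in the remaining
  variable. With p = P/F and q = Q/G the means are the integrals of P and Q divided by A and B; for
  A = B the two powers multiply to A and cancel the denominators.

  The points where F exceeds \<theta> times its majorant may form a non-measurable set. What saves
  the argument is that the pairs violating the inequality for the majorants form a measurable set,
  being described by measurable functions alone, and that a measurable set on which F is at most
  \<theta> times its majorant carries no mass of the majorant.\<close>

lemma nn_integral_exp_minus_abs_finite: "(\<integral>\<^sup>+t. ennreal (exp (- \<bar>t\<bar>)) \<partial>lborel) < \<infinity>"
proof -
  let ?e = "\<lambda>t::real. ennreal (exponential_density 1 t)"
  have 1: "(\<integral>\<^sup>+t. ?e t \<partial>lborel) = 1"
    using prob_space.emeasure_space_1[OF prob_space_exponential_density[of 1]]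
    by (simp add: emeasure_density)
  then have 2: "(\<integral>\<^sup>+t. ?e (- t) \<partial>lborel) = 1"
    using nn_integral_real_affine[of ?e "-1" 0] by simp
  have "(\<integral>\<^sup>+t. ennreal (exp (- \<bar>t\<bar>)) \<partial>lborel) \<le> (\<integral>\<^sup>+t. ?e t + ?e (- t) \<partial>lborel)"
    by (intro nn_integral_mono) (auto simp: exponential_density_def)
  also have "\<dots> = 1 + 1"
    by (subst nn_integral_add) (auto simp: 1 2)
  finally show ?thesis
    by (rule order.strict_trans1) simp
qed

text \<open>Translation is continuous in measure. Convergence in measure is expressed as L1
  convergence of a truncated distance for a finite measure; approximation by continuous functions
  reduces the claim to pointwise convergence, and L1 convergence yields an a.e. convergent
  subsequence.\<close>

lemma AE_tendsto_translation_subseq: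
  fixes \<phi> :: "real \<Rightarrow> real"
  assumes [measurable]: "\<phi> \<in> borel_measurable borel" and \<delta>: "\<delta> \<longlonglongrightarrow> 0"
  shows "\<exists>r. strict_mono r \<and> (AE t in lborel. (\<lambda>k. \<phi> (t + \<delta> (r k))) \<longlonglongrightarrow> \<phi> t)"
proof -
  \<comment> \<open>The weight makes the measure finite without changing the null sets, and a
    translation by at most 1 alters it by a factor of at most \<open>exp 1\<close>. The truncation
    in \<open>d\<close> below gives integrability even for unbounded \<phi>.\<close>
  define D where "D = density lborel (\<lambda>t. ennreal (exp (- \<bar>t\<bar>)))"
  have sets_D [measurable_cong]: "sets D = sets borel"
    by (simp add: D_def)
  interpret D: finite_measure D
    using nn_integral_exp_minus_abs_finite
    by (intro finite_measureI) (auto simp: D_def emeasure_density)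
  have AE_D: "(AE t in D. P t) \<longleftrightarrow> (AE t in lborel. P t)" for P
    unfolding D_def by (subst AE_density) auto
  define d where "d a b = min 1 \<bar>a - b\<bar>" for a b :: real
  have d_tri: "d a b \<le> d a x + d x b" and d_sym: "d a b = d b a"
    and d_nn: "0 \<le> d a b" and d_le: "d a b \<le> 1" for a b x
    by (auto simp: d_def)
  have d_meas [measurable]: "(\<lambda>t. d (u t) (v t)) \<in> borel_measurable M"
    if "u \<in> borel_measurable M" "v \<in> borel_measurable M" for u v :: "real \<Rightarrow> real" and M
    using that unfolding d_def by measurable
  have d_int: "integrable D (\<lambda>t. d (u t) (v t))"
    if [measurable]: "u \<in> borel_measurable borel" "v \<in> borel_measurable borel" for u v
    by (rule D.integrable_const_bound[where B=1])
       (auto simp: d_nn d_le sets_D)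
  have d_lim: "(\<lambda>k. \<integral>t. d (u k t) (v t) \<partial>D) \<longlonglongrightarrow> 0"
    if [measurable]: "\<And>k. u k \<in> borel_measurable borel" "v \<in> borel_measurable borel"
      and lim: "AE t in lborel. (\<lambda>k. u k t) \<longlonglongrightarrow> v t" for u v
  proof -
    have "(\<lambda>k. \<integral>t. d (u k t) (v t) \<partial>D) \<longlonglongrightarrow> (\<integral>t. 0 \<partial>D)"
    proof (rule integral_dominated_convergence[where w="\<lambda>_. 1"])
      show "AE t in D. (\<lambda>k. d (u k t) (v t)) \<longlonglongrightarrow> 0"
        unfolding AE_D using lim
      proof eventually_elim
        case (elim t)
        then have "(\<lambda>k. \<bar>u k t - v t\<bar>) \<longlonglongrightarrow> 0"
          by (intro tendsto_rabs_zero) (simp add: LIM_zero_iff)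
        then have "(\<lambda>k. d (u k t) (v t)) \<longlonglongrightarrow> min 1 0"
          unfolding d_def by (intro tendsto_intros)
        then show ?case by simp
      qed
    qed (auto simp: d_nn d_le)
    then show ?thesis by simp
  qed
  obtain N g where N: "negligible N" and g: "\<And>n. continuous_on UNIV (g n)"
    and lim: "\<And>x. x \<notin> N \<Longrightarrow> (\<lambda>n. g n x) \<longlonglongrightarrow> \<phi> x"
    using lebesgue_measurable_imp_measurable_on[of \<phi> UNIV] unfolding measurable_on_def
    by (auto simp: measurable_completion)
  have g_meas [measurable]: "g n \<in> borel_measurable borel" for n
    using g by (intro borel_measurable_continuous_onI)
  have "AE t in lborel. (\<lambda>n. g n t) \<longlonglongrightarrow> \<phi> t"
  proof -
    have "AE t in lebesgue. t \<notin> N"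
      using N by (simp add: negligible_iff_null_sets AE_not_in)
    then have "AE t in lebesgue. (\<lambda>n. g n t) \<longlonglongrightarrow> \<phi> t"
      by eventually_elim (rule lim)
    then show ?thesis by (simp add: AE_completion_iff)
  qed
  then have approx: "(\<lambda>n. \<integral>t. d (g n t) (\<phi> t) \<partial>D) \<longlonglongrightarrow> 0"
    by (intro d_lim) auto
  have shift: "(\<integral>t. d (g n (t + s)) (\<phi> (t + s)) \<partial>D) \<le> exp 1 * (\<integral>t. d (g n t) (\<phi> t) \<partial>D)"
    if "\<bar>s\<bar> \<le> 1" for s n
  proof -
    let ?h = "\<lambda>t. d (g n t) (\<phi> t)"
    have "ennreal (\<integral>t. ?h (t + s) \<partial>D) = (\<integral>\<^sup>+t. ?h (t + s) \<partial>D)"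
      by (intro nn_integral_eq_integral[symmetric] d_int) (auto simp: d_nn)
    also have "\<dots> = (\<integral>\<^sup>+t. ennreal (exp (- \<bar>t\<bar>)) * ?h (t + s) \<partial>lborel)"
      by (simp add: D_def nn_integral_density)
    also have "\<dots> = (\<integral>\<^sup>+t. ennreal (exp (- \<bar>t - s\<bar>)) * ?h t \<partial>lborel)"
      using nn_integral_real_affine[of "\<lambda>t. ennreal (exp (- \<bar>t - s\<bar>)) * ?h t" 1 s] by (simp add: add.commute)
    also have "\<dots> \<le> (\<integral>\<^sup>+t. ennreal (exp 1) * (ennreal (exp (- \<bar>t\<bar>)) * ?h t) \<partial>lborel)"
    proof (intro nn_integral_mono)
      fix t
      have "exp (- \<bar>t - s\<bar>) \<le> exp 1 * exp (- \<bar>t\<bar>)"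
        using that unfolding exp_add[symmetric] by simp
      then show "ennreal (exp (- \<bar>t - s\<bar>)) * ?h t \<le> ennreal (exp 1) * (ennreal (exp (- \<bar>t\<bar>)) * ?h t)"
        by (auto simp: ennreal_mult'[symmetric] d_nn mult.assoc[symmetric] intro!: ennreal_leI mult_right_mono)
    qed
    also have "\<dots> = ennreal (exp 1) * (\<integral>\<^sup>+t. ?h t \<partial>D)"
      by (simp add: D_def nn_integral_density nn_integral_cmult)
    also have "(\<integral>\<^sup>+t. ?h t \<partial>D) = ennreal (\<integral>t. ?h t \<partial>D)"
      by (intro nn_integral_eq_integral d_int) (auto simp: d_nn)
    finally show ?thesis
      by (simp add: ennreal_mult'[symmetric] d_nn ennreal_le_iff)
  qed
  have "(\<lambda>k. \<integral>t. d (\<phi> (t + \<delta> k)) (\<phi> t) \<partial>D) \<longlonglongrightarrow> 0"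
  proof (rule LIMSEQ_I)
    fix e :: real assume e: "0 < e"
    \<comment> \<open>Two approximation errors occur, one translated at the cost of a factor
      \<open>exp 1\<close> and one not; together they may use up half of \<open>e\<close>.\<close>
    define e' where "e' = e / (2 * (exp 1 + 1))"
    have e': "e' > 0" using e by (simp add: e'_def add_pos_pos)
    have ee: "(exp 1 + 1) * e' = e / 2"
      using add_pos_pos[of "exp 1" "1::real"] by (simp add: e'_def field_simps)
    obtain n where n: "(\<integral>t. d (g n t) (\<phi> t) \<partial>D) < e'"
      using eventually_happens'[OF _ order_tendstoD(2)[OF approx e']] by auto
    have "(\<lambda>k. \<integral>t. d (g n (t + \<delta> k)) (g n t) \<partial>D) \<longlonglongrightarrow> 0"
    proof (rule d_lim)
      have "(\<lambda>k. g n (t + \<delta> k)) \<longlonglongrightarrow> g n (t + 0)" for t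
        by (intro continuous_on_tendsto_compose[OF g] tendsto_intros \<delta>) auto
      then show "AE t in lborel. (\<lambda>k. g n (t + \<delta> k)) \<longlonglongrightarrow> g n t" by simp
    qed auto
    then have "\<forall>\<^sub>F k in sequentially. (\<integral>t. d (g n (t + \<delta> k)) (g n t) \<partial>D) < e / 2"
      using e by (intro order_tendstoD(2)[where a="e / 2"]) auto
    moreover have "\<forall>\<^sub>F k in sequentially. \<bar>\<delta> k\<bar> < 1"
      using tendsto_rabs_zero[OF \<delta>] by (intro order_tendstoD(2)) auto
    ultimately have "\<forall>\<^sub>F k in sequentially. norm ((\<integral>t. d (\<phi> (t + \<delta> k)) (\<phi> t) \<partial>D) - 0) < e"
    proof eventually_elim
      case (elim k)
      have "(\<integral>t. d (\<phi> (t + \<delta> k)) (\<phi> t) \<partial>D) \<le>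
        (\<integral>t. d (g n (t + \<delta> k)) (\<phi> (t + \<delta> k)) + (d (g n (t + \<delta> k)) (g n t) + d (g n t) (\<phi> t)) \<partial>D)"
      proof (intro integral_mono d_int Bochner_Integration.integrable_add)
        fix t
        show "d (\<phi> (t + \<delta> k)) (\<phi> t) \<le>
          d (g n (t + \<delta> k)) (\<phi> (t + \<delta> k)) + (d (g n (t + \<delta> k)) (g n t) + d (g n t) (\<phi> t))"
          using d_tri[of "\<phi> (t + \<delta> k)" "\<phi> t" "g n (t + \<delta> k)"] d_tri[of "g n (t + \<delta> k)" "\<phi> t" "g n t"]
            d_sym[of "\<phi> (t + \<delta> k)" "g n (t + \<delta> k)"] by linarith
      qed auto
      also have "\<dots> = (\<integral>t. d (g n (t + \<delta> k)) (\<phi> (t + \<delta> k)) \<partial>D) +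
          ((\<integral>t. d (g n (t + \<delta> k)) (g n t) \<partial>D) + (\<integral>t. d (g n t) (\<phi> t) \<partial>D))"
        by (simp add: d_int Bochner_Integration.integral_add)
      also have "\<dots> < exp 1 * e' + (e / 2 + e')"
        using shift[of "\<delta> k" n] elim n mult_strict_left_mono[OF n exp_gt_zero[of "1::real"]]
        by linarith
      also have "\<dots> = e"
        using ee by (simp add: algebra_simps)
      finally show ?case
        by (simp add: d_nn)
    qed
    then show "\<exists>no. \<forall>k\<ge>no. norm ((\<integral>t. d (\<phi> (t + \<delta> k)) (\<phi> t) \<partial>D) - 0) < e"
      by (simp add: eventually_sequentially)
  qed
  then obtain r :: "nat \<Rightarrow> nat" where r: "strict_mono r"
    and AE_r: "AE t in D. (\<lambda>k. d (\<phi> (t + \<delta> (r k))) (\<phi> t)) \<longlonglongrightarrow> 0"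
    using tendsto_L1_AE_subseq[of D "\<lambda>k t. d (\<phi> (t + \<delta> k)) (\<phi> t)"]
    by (auto simp: d_int d_nn)
  from AE_r have "AE t in lborel. (\<lambda>k. \<phi> (t + \<delta> (r k))) \<longlonglongrightarrow> \<phi> t"
    unfolding AE_D
  proof eventually_elim
    case (elim t)
    have "\<forall>\<^sub>F k in sequentially. d (\<phi> (t + \<delta> (r k))) (\<phi> t) < 1"
      using elim by (intro order_tendstoD(2)) auto
    then have "\<forall>\<^sub>F k in sequentially. d (\<phi> (t + \<delta> (r k))) (\<phi> t) = \<bar>\<phi> (t + \<delta> (r k)) - \<phi> t\<bar>"
      by eventually_elim (auto simp: d_def)
    with elim have "(\<lambda>k. \<bar>\<phi> (t + \<delta> (r k)) - \<phi> t\<bar>) \<longlonglongrightarrow> 0"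
      by (simp add: tendsto_cong)
    then show ?case
      by (simp add: tendsto_rabs_zero_iff LIM_zero_iff)
  qed
  with r show ?thesis by blast
qed

text \<open>The map is the quantile function, the generalized inverse \<open>I\<close> of the
  distribution function of F dx. Transporting both densities from the unit interval, instead of one
  onto the other, gives a common parameter and avoids inverting either map.\<close>

lemma monotone_transport_from_unit_interval:
  fixes F :: "real \<Rightarrow> ennreal"
  assumes [measurable]: "F \<in> borel_measurable borel" and F: "(\<integral>\<^sup>+s. F s \<partial>lborel) = 1"
  obtains x :: "real \<Rightarrow> real" where "x \<in> borel_measurable (restrict_space lborel {0<..<1})"
    and "mono_on {0<..<1} x"
    and "distr (restrict_space lborel {0<..<1}) borel x = density lborel F"
proof -
  interpret cdf_distribution "density lborel F"
    unfolding cdf_distribution_def real_distribution_def real_distribution_axioms_def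
    using F by (auto intro!: prob_spaceI simp: emeasure_density)
  have "borel_measurable (restrict_space lborel {0<..<1}) = borel_measurable (restrict_space borel {0<..<1::real})"
    by (intro measurable_cong_sets sets_restrict_space_cong) auto
  then show ?thesis
    using that[of I] mono_I distr_I_eq_M measurable_CI by auto
qed

lemma emeasure_le_lborel_if_le_on_intervals:
  fixes N :: "real measure"
  assumes sets_N [measurable_cong]: "sets N = sets borel"
    and le: "\<And>a b. a \<le> b \<Longrightarrow> emeasure N {a..b} \<le> ennreal (b - a)"
    and A: "A \<in> sets borel"
  shows "emeasure N A \<le> emeasure lborel A"
proof -
  \<comment> \<open>The case of a degenerate interval shows that endpoints are null for
    \<open>N\<close>. This matters because only the interiors of the covering intervals are
    disjoint.\<close>
  have point: "{t} \<in> null_sets N" for t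
    using le[of t t] by (auto simp: null_sets_def)
  have bounded: "emeasure N B \<le> emeasure lborel B" if B: "B \<in> sets borel" "B \<subseteq> {a..b}" for a b B
  proof (rule ennreal_le_epsilon)
    fix e :: real assume e: "0 < e"
    have Bl: "B \<in> lmeasurable"
      using B by (intro bounded_set_imp_lmeasurable bounded_subset[OF bounded_closed_interval, of B]) auto
    have Bc: "B \<subseteq> cbox a b" using B by simp
    have "\<exists>\<D>. countable \<D> \<and> (\<forall>K\<in>\<D>. \<exists>c d. c \<le> d \<and> K = {c..d}) \<and>
        pairwise (\<lambda>A B. interior A \<inter> interior B = {}) \<D> \<and> B \<subseteq> \<Union>\<D> \<and>
        \<Union>\<D> \<in> lmeasurable \<and> measure lebesgue (\<Union>\<D>) \<le> measure lebesgue B + e"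
    proof (rule measurable_outer_intervals_bounded[OF Bl Bc e])
      fix \<D> assume *: "countable \<D>"
        "\<And>K. K \<in> \<D> \<Longrightarrow> K \<subseteq> cbox a b \<and> K \<noteq> {} \<and> (\<exists>c d. K = cbox c d)"
        "pairwise (\<lambda>A B. interior A \<inter> interior B = {}) \<D>"
        "B \<subseteq> \<Union>\<D>" "\<Union>\<D> \<in> lmeasurable" "measure lebesgue (\<Union>\<D>) \<le> measure lebesgue B + e"
      have "\<exists>c d. c \<le> d \<and> K = {c..d}" if "K \<in> \<D>" for K
        using *(2)[OF that] unfolding box_real by (metis atLeastatMost_empty_iff)
      with * show ?thesis by (intro exI[of _ \<D>]) simp
    qed
    then obtain \<D> where \<D>: "countable \<D>" "\<And>K. K \<in> \<D> \<Longrightarrow> \<exists>c d. c \<le> d \<and> K = {c..d}"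
        "pairwise (\<lambda>A B. interior A \<inter> interior B = {}) \<D>"
        "B \<subseteq> \<Union>\<D>" "\<Union>\<D> \<in> lmeasurable" "measure lebesgue (\<Union>\<D>) \<le> measure lebesgue B + e"
      by metis
    have Kb [measurable]: "K \<in> sets borel" if "K \<in> \<D>" for K
      using \<D>(2) that by force
    have Km [measurable]: "\<Union>\<D> \<in> sets borel"
      using \<D>(1) by (intro sets.countable_Union) (auto simp: Kb)
    have Ki [measurable]: "(\<Union>K\<in>\<D>. interior K) \<in> sets borel"
      by (intro borel_open open_UN) auto
    have dis: "disjoint_family_on interior \<D>"
      using \<D>(3) by (auto simp: disjoint_family_on_def pairwise_def)
    have K_le: "emeasure N (interior K) \<le> emeasure lborel (interior K)"
      and K_null: "K - interior K \<in> null_sets N" if "K \<in> \<D>" for K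
    proof -
      obtain c d where K: "K = {c..d}" and cd: "c \<le> d"
        using \<D>(2) \<open>K \<in> \<D>\<close> by blast
      have "emeasure N (interior K) \<le> emeasure N {c..d}"
        using K by (intro emeasure_mono) (auto simp: sets_N)
      then show "emeasure N (interior K) \<le> emeasure lborel (interior K)"
        using le[OF cd] cd by (auto simp: K interior_atLeastAtMost_real)
      have "K - interior K = {c} \<union> {d}"
        using cd by (auto simp: K interior_atLeastAtMost_real)
      then show "K - interior K \<in> null_sets N"
        using null_sets.Un[OF point point] by simp
    qed
    have nullN: "(\<Union>K\<in>\<D>. K - interior K) \<in> null_sets N"
      by (intro null_sets_UN' \<D>(1) K_null)
    have "emeasure N B \<le> emeasure N ((\<Union>K\<in>\<D>. interior K) \<union> (\<Union>K\<in>\<D>. K - interior K))"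
      using \<D>(4) nullN by (intro emeasure_mono) (auto simp: sets_N Km dest: null_setsD2)
    also have "\<dots> = emeasure N (\<Union>K\<in>\<D>. interior K)"
      using nullN by (intro emeasure_Un_null_set) (auto simp: sets_N Ki)
    also have "\<dots> = (\<integral>\<^sup>+K. emeasure N (interior K) \<partial>count_space \<D>)"
      by (intro emeasure_UN_countable \<D>(1) dis) (auto simp: sets_N)
    also have "\<dots> \<le> (\<integral>\<^sup>+K. emeasure lborel (interior K) \<partial>count_space \<D>)"
      by (intro nn_integral_mono K_le) auto
    also have "\<dots> = emeasure lborel (\<Union>K\<in>\<D>. interior K)"
      by (intro emeasure_UN_countable[symmetric] \<D>(1) dis) auto
    also have "\<dots> \<le> emeasure lborel (\<Union>\<D>)"
      using interior_subset by (intro emeasure_mono) (auto simp: Km)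
    also have "\<dots> = ennreal (measure lebesgue (\<Union>\<D>))"
      using emeasure_eq_measure2[OF \<D>(5)] Km by simp
    also have "\<dots> \<le> ennreal (measure lebesgue B + e)"
      using \<D>(6) by (rule ennreal_leI)
    also have "\<dots> = emeasure lborel B + ennreal e"
      using emeasure_eq_measure2[OF Bl] B e by (simp add: ennreal_plus)
    finally show "emeasure N B \<le> emeasure lborel B + ennreal e" .
  qed
  have U: "(\<Union>n::nat. A \<inter> {- real n..real n}) = A"
  proof -
    have "\<exists>n::nat. - real n \<le> t \<and> t \<le> real n" for t
      using real_arch_simple[of "\<bar>t\<bar>"] unfolding abs_le_iff by (metis minus_le_iff)
    then show ?thesis by auto
  qed
  have "emeasure N A = (SUP n::nat. emeasure N (A \<inter> {- real n..real n}))"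
  proof (subst SUP_emeasure_incseq)
    show "emeasure N A = emeasure N (\<Union>n::nat. A \<inter> {- real n..real n})"
      by (simp only: U)
  qed (use A in \<open>auto simp: incseq_def sets_N\<close>)
  also have "\<dots> \<le> emeasure lborel A"
  proof (rule SUP_least)
    fix n :: nat
    have "emeasure N (A \<inter> {- real n..real n}) \<le> emeasure lborel (A \<inter> {- real n..real n})"
      using A by (intro bounded[of _ "- real n" "real n"]) auto
    also have "\<dots> \<le> emeasure lborel A"
      using A by (intro emeasure_mono) auto
    finally show "emeasure N (A \<inter> {- real n..real n}) \<le> emeasure lborel A" .
  qed
  finally show ?thesis .
qed

lemma AE_imp_ex_small_pos:
  assumes "AE \<delta> in lborel. P \<delta>" and "0 < (e::real)"
  shows "\<exists>\<delta>. 0 < \<delta> \<and> \<delta> < e \<and> P \<delta>"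
proof (rule ccontr)
  assume "\<not> ?thesis"
  then have "AE \<delta> in lborel. \<delta> \<notin> {0<..<e}"
    using assms(1) by (auto elim: eventually_mono)
  then have "{0<..<e} \<in> null_sets lborel"
    by (subst (asm) AE_iff_null_sets[symmetric]) auto
  with \<open>0 < e\<close> show False
    by (auto simp: null_sets_def)
qed

lemma AE_lborel_plus:
  fixes c :: real
  assumes "AE t in lborel. P t"
  shows "AE t in lborel. P (c + t)"
proof (rule AE_distrD[where M'=borel and f="(+) c"])
  show "AE t in distr lborel borel ((+) c). P t"
    unfolding lborel_distr_plus by (rule assms)
qed simp

section \<open>Jacobian bounds for quantile maps\<close>

locale unit_interval_transport =
  fixes F x :: "real \<Rightarrow> real"
  assumes F_meas [measurable]: "F \<in> borel_measurable borel" and F_nn: "\<And>s. 0 \<le> F s"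
    and x_meas [measurable]: "x \<in> borel_measurable (restrict_space lborel {0<..<1})"
    and x_mono: "mono_on {0<..<1} x"
    and x_distr: "distr (restrict_space lborel {0<..<1}) borel x = density lborel F"
begin

lemma nn_integral_transport:
  assumes [measurable]: "h \<in> borel_measurable borel"
  shows "(\<integral>\<^sup>+u. h (x u) \<partial>restrict_space lborel {0<..<1}) = (\<integral>\<^sup>+s. ennreal (F s) * h s \<partial>lborel)"
proof -
  have "(\<integral>\<^sup>+u. h (x u) \<partial>restrict_space lborel {0<..<1}) =
      (\<integral>\<^sup>+s. h s \<partial>distr (restrict_space lborel {0<..<1}) borel x)"
    by (subst nn_integral_distr) auto
  then show ?thesis
    by (simp add: x_distr nn_integral_density)
qed

lemma AE_transport:
  assumes "AE s in lborel. 0 < F s \<longrightarrow> P s"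
  shows "AE u in restrict_space lborel {0<..<1}. P (x u)"
proof (rule AE_distrD[where M'=borel and f=x])
  show "AE s in distr (restrict_space lborel {0<..<1}) borel x. P s"
    unfolding x_distr using assms by (subst AE_density) auto
qed (rule x_meas)

text \<open>Integrated substitute for the derivative x'(u) = 1 / F(x u), which need not exist. Where
  F vanishes, division by zero gives 0, so F * (1 / F) never exceeds 1.\<close>

lemma transport_length:
  assumes "c \<le> d"
  shows "(\<integral>\<^sup>+u. ennreal (1 / F (x u)) * indicator {c..d} (x u) \<partial>restrict_space lborel {0<..<1})
    \<le> ennreal (d - c)"
proof -
  have "(\<integral>\<^sup>+u. ennreal (1 / F (x u)) * indicator {c..d} (x u) \<partial>restrict_space lborel {0<..<1}) =
      (\<integral>\<^sup>+s. ennreal (F s) * (ennreal (1 / F s) * indicator {c..d} s) \<partial>lborel)"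
    by (rule nn_integral_transport) measurable
  also have "\<dots> \<le> (\<integral>\<^sup>+s. indicator {c..d} s \<partial>lborel)"
  proof (intro nn_integral_mono)
    fix s
    have "ennreal (F s) * ennreal (1 / F s) \<le> 1"
      using F_nn[of s] by (subst ennreal_mult'[symmetric]) auto
    then have "ennreal (F s) * ennreal (1 / F s) * indicator {c..d} s \<le> 1 * indicator {c..d} s"
      by (rule mult_right_mono) simp
    then show "ennreal (F s) * (ennreal (1 / F s) * indicator {c..d} s) \<le> indicator {c..d} s"
      by (simp add: mult.assoc)
  qed
  also have "\<dots> = ennreal (d - c)"
    using assms by simp
  finally show ?thesis .
qed

end

text \<open>Change of variables for w = (1-l) x + l y, with the formal derivative (1-l)/F + l/G as
  weight. The image under w of the weighted measure is dominated by Lebesgue measure once this is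
  known on intervals, and there it follows from \<open>transport_length\<close> applied to the
  ranges of x and y separately.\<close>

lemma nn_integral_interpolated_transport:
  fixes l :: real
  defines "U \<equiv> restrict_space lborel {0<..<1::real}"
  assumes F: "unit_interval_transport F x" and G: "unit_interval_transport G y"
    and l: "0 < l" "l < 1" and [measurable]: "h \<in> borel_measurable borel"
  shows "(\<integral>\<^sup>+u. h ((1 - l) * x u + l * y u) * ennreal ((1 - l) / F (x u) + l / G (y u)) \<partial>U)
    \<le> (\<integral>\<^sup>+t. h t \<partial>lborel)"
proof -
  interpret F: unit_interval_transport F x by fact
  interpret G: unit_interval_transport G y by fact
  define w where "w u = (1 - l) * x u + l * y u" for u
  define J where "J u = ennreal ((1 - l) / F (x u) + l / G (y u))" for u
  have space_U: "space U = {0<..<1}"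
    by (simp add: U_def space_restrict_space)
  have x [measurable]: "x \<in> borel_measurable U" and y [measurable]: "y \<in> borel_measurable U"
    unfolding U_def by measurable
  have [measurable]: "w \<in> borel_measurable U" "J \<in> borel_measurable U"
    unfolding w_def J_def by measurable
  define N where "N = distr (density U J) borel w"
  have sets_N: "sets N = sets borel"
    by (simp add: N_def)
  have int_N: "(\<integral>\<^sup>+t. g t \<partial>N) = (\<integral>\<^sup>+u. g (w u) * J u \<partial>U)"
    if [measurable]: "g \<in> borel_measurable borel" for g
    by (simp add: N_def nn_integral_distr nn_integral_density mult.commute)
  have interval: "emeasure N {a..b} \<le> ennreal (b - a)" if "a \<le> b" for a b
  proof -
    define K where "K = {u\<in>{0<..<1}. a \<le> w u \<and> w u \<le> b}"
    have eq: "emeasure N {a..b} = (\<integral>\<^sup>+u. indicator K u * J u \<partial>U)"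
    proof -
      have "emeasure N {a..b} = (\<integral>\<^sup>+t. indicator {a..b} t \<partial>N)"
        by (simp add: sets_N)
      also have "\<dots> = (\<integral>\<^sup>+u. indicator {a..b} (w u) * J u \<partial>U)"
        by (rule int_N) simp
      also have "\<dots> = (\<integral>\<^sup>+u. indicator K u * J u \<partial>U)"
        by (intro nn_integral_cong) (auto simp: K_def space_U indicator_def)
      finally show ?thesis .
    qed
    show ?thesis
    proof (cases "K = {}")
      case True
      then show ?thesis by (simp add: eq)
    next
      case False
      then obtain u0 where u0: "u0 \<in> K" by blast
      \<comment> \<open>Monotonicity traps the mixed value between the values of w at the smaller
        and at the larger parameter. Thus x and y may be evaluated at independent points of
        \<open>K\<close>, which lets their ranges be extremized separately.\<close>
      have cross: "a \<le> (1 - l) * x u + l * y v \<and> (1 - l) * x u + l * y v \<le> b"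
        if "u \<in> K" "v \<in> K" for u v
      proof -
        have le: "x (min u v) \<le> x u" "y (min u v) \<le> y v" "x u \<le> x (max u v)" "y v \<le> y (max u v)"
          using that by (auto simp: K_def intro!: mono_onD[OF F.x_mono] mono_onD[OF G.x_mono])
        have "min u v \<in> K" "max u v \<in> K"
          using that by (auto simp: min_def max_def)
        then have "a \<le> w (min u v)" "w (max u v) \<le> b"
          by (auto simp: K_def)
        moreover have "w (min u v) \<le> (1 - l) * x u + l * y v" "(1 - l) * x u + l * y v \<le> w (max u v)"
          unfolding w_def using l le by (auto intro!: add_mono mult_left_mono)
        ultimately show ?thesis by linarith
      qed
      define xi xs yi ys where "xi = Inf (x ` K)" and "xs = Sup (x ` K)"
        and "yi = Inf (y ` K)" and "ys = Sup (y ` K)"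
      have x_lo: "(a - l * y v) / (1 - l) \<le> x u" and x_hi: "x u \<le> (b - l * y v) / (1 - l)"
        and y_lo: "(a - (1 - l) * x u) / l \<le> y v" and y_hi: "y v \<le> (b - (1 - l) * x u) / l"
        if "u \<in> K" "v \<in> K" for u v
        using cross[OF that] l by (auto simp: field_simps)
      have bdd: "bdd_below (x ` K)" "bdd_above (x ` K)" "bdd_below (y ` K)" "bdd_above (y ` K)"
        using x_lo[OF _ u0] x_hi[OF _ u0] y_lo[OF u0] y_hi[OF u0]
        by (auto intro!: bdd_belowI2 bdd_aboveI2)
      have xK: "xi \<le> x u \<and> x u \<le> xs" and yK: "yi \<le> y u \<and> y u \<le> ys" if "u \<in> K" for u
        using that bdd unfolding xi_def xs_def yi_def ys_def
        by (auto intro: cINF_lower cSUP_upper)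
      \<comment> \<open>By \<open>cross\<close> the extremes in u can be taken with v fixed, and
        then the extremes in v; the lengths of the two ranges therefore add up, with weights, to at
        most that of the target interval.\<close>
      have width: "(1 - l) * (xs - xi) + l * (ys - yi) \<le> b - a"
      proof -
        have "xs \<le> (b - l * y v) / (1 - l)" "(a - l * y v) / (1 - l) \<le> xi" if "v \<in> K" for v
          unfolding xs_def xi_def using False x_lo x_hi that
          by (auto intro!: cSUP_least cINF_greatest)
        then have "y v \<le> (b - (1 - l) * xs) / l" "(a - (1 - l) * xi) / l \<le> y v" if "v \<in> K" for v
          using that l by (auto simp: field_simps)
        then have "ys \<le> (b - (1 - l) * xs) / l" "(a - (1 - l) * xi) / l \<le> yi"
          unfolding ys_def yi_def using False by (auto intro!: cSUP_least cINF_greatest)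
        then show ?thesis
          using l by (auto simp: field_simps)
      qed
      have xile: "xi \<le> xs" "yi \<le> ys"
        using xK[OF u0] yK[OF u0] by auto
      have "emeasure N {a..b} \<le> (\<integral>\<^sup>+u. ennreal (1 - l) * (ennreal (1 / F (x u)) * indicator {xi..xs} (x u)) +
          ennreal l * (ennreal (1 / G (y u)) * indicator {yi..ys} (y u)) \<partial>U)"
        unfolding eq
      proof (intro nn_integral_mono)
        fix u
        show "indicator K u * J u \<le> ennreal (1 - l) * (ennreal (1 / F (x u)) * indicator {xi..xs} (x u)) +
          ennreal l * (ennreal (1 / G (y u)) * indicator {yi..ys} (y u))"
        proof (cases "u \<in> K")
          case True
          have "J u = ennreal (1 - l) * ennreal (1 / F (x u)) + ennreal l * ennreal (1 / G (y u))"
            unfolding J_def using l F.F_nn[of "x u"] G.F_nn[of "y u"]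
            by (subst ennreal_plus) (simp_all add: ennreal_mult'[symmetric])
          with True xK[OF True] yK[OF True] show ?thesis by simp
        qed simp
      qed
      also have "\<dots> = ennreal (1 - l) * (\<integral>\<^sup>+u. ennreal (1 / F (x u)) * indicator {xi..xs} (x u) \<partial>U) +
          ennreal l * (\<integral>\<^sup>+u. ennreal (1 / G (y u)) * indicator {yi..ys} (y u) \<partial>U)"
        by (simp add: nn_integral_add nn_integral_cmult)
      also have "\<dots> \<le> ennreal (1 - l) * ennreal (xs - xi) + ennreal l * ennreal (ys - yi)"
        unfolding U_def using xile
        by (intro add_mono mult_left_mono F.transport_length G.transport_length) auto
      also have "\<dots> = ennreal ((1 - l) * (xs - xi) + l * (ys - yi))"
        using l xile by (subst ennreal_plus) (simp_all add: ennreal_mult)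
      also have "\<dots> \<le> ennreal (b - a)"
        using width by (rule ennreal_leI)
      finally show ?thesis .
    qed
  qed
  have "(\<integral>\<^sup>+t. h t \<partial>N) \<le> (\<integral>\<^sup>+t. h t \<partial>lborel)"
  proof (rule nn_integral_mono_measure)
    show "N \<le> lborel"
      using emeasure_le_lborel_if_le_on_intervals[OF sets_N interval]
      by (intro le_measure[THEN iffD2] le_funI) (auto simp: sets_N emeasure_notin_sets)
  qed (simp add: sets_N)
  then show ?thesis
    by (simp add: int_N w_def J_def)
qed

text \<open>Weighted AM-GM bounds the Jacobian (1-l)/F + l/G below by F^-(1-l) G^-l, which cancels
  the powers in the hypothesis. What remains along the common parameter is (1-l) p(x u) + l q(y u),
  and its integral over the unit interval is the left side.\<close>

lemma one_dim_inequality_normalized: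
  fixes F G p q :: "real \<Rightarrow> real" and M :: "real \<Rightarrow> ennreal" and l :: real
  assumes l: "0 < l" "l < 1"
    and [measurable]: "F \<in> borel_measurable borel" "G \<in> borel_measurable borel"
      "p \<in> borel_measurable borel" "q \<in> borel_measurable borel" "M \<in> borel_measurable borel"
    and nn: "\<And>s. 0 \<le> F s" "\<And>s. 0 \<le> G s" "\<And>s. 0 \<le> p s" "\<And>s. 0 \<le> q s"
    and F1: "(\<integral>\<^sup>+s. F s \<partial>lborel) = 1" and G1: "(\<integral>\<^sup>+s. G s \<partial>lborel) = 1"
    and le: "AE z in lborel \<Otimes>\<^sub>M lborel.
      ennreal (F (fst z) powr (1 - l) * G (snd z) powr l * ((1 - l) * p (fst z) + l * q (snd z)))
        \<le> M ((1 - l) * fst z + l * snd z)"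
  shows "ennreal (1 - l) * (\<integral>\<^sup>+s. ennreal (F s) * ennreal (p s) \<partial>lborel) +
      ennreal l * (\<integral>\<^sup>+s. ennreal (G s) * ennreal (q s) \<partial>lborel) \<le> (\<integral>\<^sup>+t. M t \<partial>lborel)"
proof -
  define U where "U = restrict_space lborel {0<..<1::real}"
  obtain x :: "real \<Rightarrow> real" where x: "x \<in> borel_measurable U" "mono_on {0<..<1} x"
      "distr U borel x = density lborel F"
    using monotone_transport_from_unit_interval[of "\<lambda>s. ennreal (F s)"] F1 unfolding U_def by auto
  obtain y :: "real \<Rightarrow> real" where y: "y \<in> borel_measurable U" "mono_on {0<..<1} y"
      "distr U borel y = density lborel G"
    using monotone_transport_from_unit_interval[of "\<lambda>s. ennreal (G s)"] G1 unfolding U_def by auto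
  interpret F: unit_interval_transport F x
    using x nn by unfold_locales (auto simp: U_def)
  interpret G: unit_interval_transport G y
    using y nn by unfold_locales (auto simp: U_def)
  note [measurable] = x(1) y(1)
  interpret U: prob_space U
    by (rule prob_spaceI) (simp add: U_def emeasure_restrict_space space_restrict_space)
  interpret UL: pair_sigma_finite U "lborel :: real measure" ..
  define Q where "Q s t \<longleftrightarrow> ennreal (F s powr (1 - l) * G t powr l * ((1 - l) * p s + l * q t))
      \<le> M ((1 - l) * s + l * t)" for s t
  have "AE s in lborel. AE t in lborel. Q s t"
    using lborel_pair.AE_pair[OF le] by (simp add: Q_def)
  then have "AE u in U. AE t in lborel. Q (x u) t"
    unfolding U_def by (intro F.AE_transport) (auto elim: eventually_mono)
  \<comment> \<open>For fixed u, translation by \<open>y u\<close> turns the null set of exceptional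
    t into a null set of exceptional \<delta>. Exchanging the quantifiers by Fubini then gives
    shifts each of which serves almost every u.\<close>
  then have "AE u in U. AE \<delta> in lborel. Q (x u) (y u + \<delta>)"
    by eventually_elim (rule AE_lborel_plus)
  moreover have [measurable]: "(\<lambda>z. x (fst z)) \<in> borel_measurable (U \<Otimes>\<^sub>M lborel)"
      "(\<lambda>z. y (fst z)) \<in> borel_measurable (U \<Otimes>\<^sub>M lborel)"
      "(\<lambda>z. snd z) \<in> borel_measurable (U \<Otimes>\<^sub>M lborel)"
    by (rule measurable_compose[OF measurable_fst x(1)] measurable_compose[OF measurable_fst y(1)]
        measurable_compose[OF measurable_snd measurable_ident_sets[OF sets_lborel]])+
  then have "{z \<in> space (U \<Otimes>\<^sub>M lborel). Q (x (fst z)) (y (fst z) + snd z)} \<in> sets (U \<Otimes>\<^sub>M lborel)"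
    unfolding Q_def by (intro borel_measurable_le) measurable
  ultimately have good: "AE \<delta> in lborel. AE u in U. Q (x u) (y u + \<delta>)"
    by (subst (asm) UL.AE_commute) auto
  have "\<exists>\<delta>. 0 < \<delta> \<and> \<delta> < inverse (real (Suc k)) \<and> (AE u in U. Q (x u) (y u + \<delta>))" for k
    by (intro AE_imp_ex_small_pos[OF good]) simp
  then obtain \<delta>0 where \<delta>0: "\<And>k. 0 < \<delta>0 k" "\<And>k. \<delta>0 k < inverse (real (Suc k))"
      "\<And>k. AE u in U. Q (x u) (y u + \<delta>0 k)"
    by metis
  have \<delta>0_lim: "\<delta>0 \<longlonglongrightarrow> 0"
    by (rule tendsto_sandwich[OF _ _ tendsto_const LIMSEQ_inverse_real_of_nat])
       (use \<delta>0(1,2) in \<open>auto intro!: always_eventually less_imp_le\<close>)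
  \<comment> \<open>Only the second point is shifted, so only G and q must converge; the subsequence
    for q refines the one for G.\<close>
  obtain r1 where r1: "strict_mono r1" "AE t in lborel. (\<lambda>k. G (t + \<delta>0 (r1 k))) \<longlonglongrightarrow> G t"
    using AE_tendsto_translation_subseq[of G, OF _ \<delta>0_lim] by auto
  obtain r2 where r2: "strict_mono r2" "AE t in lborel. (\<lambda>k. q (t + \<delta>0 (r1 (r2 k)))) \<longlonglongrightarrow> q t"
    using AE_tendsto_translation_subseq[of q "\<lambda>k. \<delta>0 (r1 k)"] LIMSEQ_subseq_LIMSEQ[OF \<delta>0_lim r1(1)]
    by (auto simp: o_def)
  define \<delta> where "\<delta> k = \<delta>0 (r1 (r2 k))" for k
  have q_lim: "AE t in lborel. (\<lambda>k. q (t + \<delta> k)) \<longlonglongrightarrow> q t"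
    using r2(2) by (simp add: \<delta>_def)
  have G_lim: "AE t in lborel. (\<lambda>k. G (t + \<delta> k)) \<longlonglongrightarrow> G t"
    using r1(2)
  proof eventually_elim
    case (elim t)
    from LIMSEQ_subseq_LIMSEQ[OF this r2(1)] show ?case by (simp add: \<delta>_def o_def)
  qed
  have pos: "AE u in U. 0 < F (x u) \<and> 0 < G (y u)"
    unfolding U_def by (intro AE_conjI F.AE_transport G.AE_transport) auto
  \<comment> \<open>The hypothesis sees G at the shifted point, the Jacobian sees it at the
    unshifted one. The quotient records this discrepancy and tends to 1 for almost every u.\<close>
  define Z where "Z k u = ennreal ((G (y u + \<delta> k) / G (y u)) powr l * ((1 - l) * p (x u) + l * q (y u + \<delta> k)))"
    for k u
  have [measurable]: "Z k \<in> borel_measurable U" for k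
    unfolding Z_def by measurable
  have Z_le: "(\<integral>\<^sup>+u. Z k u \<partial>U) \<le> (\<integral>\<^sup>+t. M t \<partial>lborel)" for k
  proof -
    have "(\<integral>\<^sup>+u. Z k u \<partial>U) \<le> (\<integral>\<^sup>+u. M (((1 - l) * x u + l * y u) + l * \<delta> k) *
        ennreal ((1 - l) / F (x u) + l / G (y u)) \<partial>U)"
    proof (rule nn_integral_mono_AE)
      show "AE u in U. Z k u \<le> M (((1 - l) * x u + l * y u) + l * \<delta> k) * ennreal ((1 - l) / F (x u) + l / G (y u))"
        using pos \<delta>0(3)[of "r1 (r2 k)"]
      proof eventually_elim
        case (elim u)
        let ?f = "F (x u)" and ?g = "G (y u)" and ?g' = "G (y u + \<delta> k)"
          and ?c = "(1 - l) * p (x u) + l * q (y u + \<delta> k)"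
        have f: "0 < ?f" and g: "0 < ?g" using elim by auto
        have c: "0 \<le> ?c" using l nn by auto
        have young: "(1 / ?f) powr (1 - l) * (1 / ?g) powr l \<le> (1 - l) / ?f + l / ?g"
          using Youngs_inequality_0[of "1 - l" l "1 / ?f" "1 / ?g"] l f g by simp
        have "(?g' / ?g) powr l * ?c =
            (?f powr (1 - l) * ?g' powr l * ?c) * ((1 / ?f) powr (1 - l) * (1 / ?g) powr l)"
          using f g nn by (simp add: powr_divide field_simps)
        also have "\<dots> \<le> (?f powr (1 - l) * ?g' powr l * ?c) * ((1 - l) / ?f + l / ?g)"
          using c by (intro mult_left_mono[OF young]) auto
        finally have "Z k u \<le> ennreal ((?f powr (1 - l) * ?g' powr l * ?c) * ((1 - l) / ?f + l / ?g))"
          unfolding Z_def by (rule ennreal_leI)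
        also have "\<dots> = ennreal (?f powr (1 - l) * ?g' powr l * ?c) * ennreal ((1 - l) / ?f + l / ?g)"
          using c by (intro ennreal_mult') simp
        also have "\<dots> \<le> M (((1 - l) * x u + l * y u) + l * \<delta> k) * ennreal ((1 - l) / ?f + l / ?g)"
          using elim(2) unfolding Q_def
          by (intro mult_right_mono) (simp_all add: \<delta>_def algebra_simps)
        finally show ?case .
      qed
    qed
    \<comment> \<open>Shifting the second point by \<delta> shifts the combination by l times
      \<delta>, which translation invariance removes; hence the bound is the same for all k.\<close>
    also have "\<dots> \<le> (\<integral>\<^sup>+t. M (t + l * \<delta> k) \<partial>lborel)"
      unfolding U_def
      by (rule nn_integral_interpolated_transport[of F x G y l "\<lambda>t. M (t + l * \<delta> k)"])
         (use l F.unit_interval_transport_axioms G.unit_interval_transport_axioms in auto)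
    also have "\<dots> = (\<integral>\<^sup>+t. M t \<partial>lborel)"
      using nn_integral_real_affine[of M 1 "l * \<delta> k"] by (simp add: add.commute)
    finally show ?thesis .
  qed
  have lim: "AE u in U. (\<lambda>k. Z k u) \<longlonglongrightarrow> ennreal ((1 - l) * p (x u) + l * q (y u))"
  proof -
    have "AE u in U. (\<lambda>k. G (y u + \<delta> k)) \<longlonglongrightarrow> G (y u)"
      using G_lim unfolding U_def by (intro G.AE_transport) (auto elim: eventually_mono)
    moreover have "AE u in U. (\<lambda>k. q (y u + \<delta> k)) \<longlonglongrightarrow> q (y u)"
      using q_lim unfolding U_def by (intro G.AE_transport) (auto elim: eventually_mono)
    ultimately show ?thesis using pos
    proof eventually_elim
      case (elim u)
      then have "(\<lambda>k. (G (y u + \<delta> k) / G (y u)) powr l * ((1 - l) * p (x u) + l * q (y u + \<delta> k)))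
          \<longlonglongrightarrow> (G (y u) / G (y u)) powr l * ((1 - l) * p (x u) + l * q (y u))"
        by (intro tendsto_intros) auto
      then show ?case
        using elim unfolding Z_def by (intro tendsto_ennrealI) simp
    qed
  qed
  have "ennreal (1 - l) * (\<integral>\<^sup>+s. ennreal (F s) * ennreal (p s) \<partial>lborel) +
      ennreal l * (\<integral>\<^sup>+s. ennreal (G s) * ennreal (q s) \<partial>lborel) =
      ennreal (1 - l) * (\<integral>\<^sup>+u. ennreal (p (x u)) \<partial>U) + ennreal l * (\<integral>\<^sup>+u. ennreal (q (y u)) \<partial>U)"
    unfolding U_def by (simp add: F.nn_integral_transport[of "\<lambda>s. ennreal (p s)"]
        G.nn_integral_transport[of "\<lambda>s. ennreal (q s)"])
  also have "\<dots> = (\<integral>\<^sup>+u. ennreal (1 - l) * ennreal (p (x u)) + ennreal l * ennreal (q (y u)) \<partial>U)"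
    by (simp add: nn_integral_add nn_integral_cmult)
  also have "\<dots> = (\<integral>\<^sup>+u. liminf (\<lambda>k. Z k u) \<partial>U)"
    using lim
  proof (intro nn_integral_cong_AE, eventually_elim)
    case (elim u)
    from lim_imp_Liminf[OF _ elim(2)] show ?case
      using l nn by (simp add: ennreal_mult)
  qed
  \<comment> \<open>Fatou turns the bound uniform in k into a bound for the limit, with no
    dominating function for \<open>Z\<close>.\<close>
  also have "\<dots> \<le> liminf (\<lambda>k. \<integral>\<^sup>+u. Z k u \<partial>U)"
    by (rule nn_integral_liminf) simp
  also have "\<dots> \<le> (\<integral>\<^sup>+t. M t \<partial>lborel)"
    using Liminf_mono[of "\<lambda>k. \<integral>\<^sup>+u. Z k u \<partial>U" "\<lambda>_. \<integral>\<^sup>+t. M t \<partial>lborel" sequentially] Z_le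
    by (simp add: Liminf_const)
  finally show ?thesis .
qed

section \<open>Extended values and arbitrary positive finite masses in one variable\<close>

lemma measurable_ennreal_pow [measurable]:
  assumes [measurable]: "f \<in> borel_measurable M"
  shows "(\<lambda>x. ennreal_pow (f x) a) \<in> borel_measurable M"
  unfolding ennreal_pow_def infinity_ennreal_def by measurable

lemma ennreal_pow_ennreal: "0 \<le> x \<Longrightarrow> ennreal_pow (ennreal x) a = ennreal (x powr a)"
  by (simp add: ennreal_pow_def)

lemma ennreal_pow_0 [simp]: "ennreal_pow 0 a = 0"
  by (simp add: ennreal_pow_def)

lemma SUP_min_of_nat_ennreal: "(SUP n. min x (of_nat n)) = (x::ennreal)"
proof (rule antisym)
  show "(SUP n. min x (of_nat n)) \<le> x"
    by (rule SUP_least) simp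
  show "x \<le> (SUP n. min x (of_nat n))"
  proof (cases x)
    case (real r)
    then obtain n where "x \<le> of_nat n"
      using real_arch_simple[of r] by (auto simp: ennreal_of_nat_eq_real_of_nat ennreal_leI)
    then show ?thesis
      by (intro SUP_upper2[of n]) auto
  next
    case top
    then show ?thesis by (simp add: ennreal_SUP_of_nat_eq_top)
  qed
qed

lemma nn_integral_mult_truncation:
  assumes [measurable]: "F \<in> borel_measurable N" "p \<in> borel_measurable N"
  shows "(\<integral>\<^sup>+s. F s * p s \<partial>N) = (SUP n. \<integral>\<^sup>+s. F s * min (p s) (of_nat n) \<partial>N)"
proof -
  have "(\<integral>\<^sup>+s. F s * p s \<partial>N) = (\<integral>\<^sup>+s. (SUP n. F s * min (p s) (of_nat n)) \<partial>N)"
    by (simp add: SUP_mult_left_ennreal[symmetric] SUP_min_of_nat_ennreal)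
  also have "\<dots> = (SUP n. \<integral>\<^sup>+s. F s * min (p s) (of_nat n) \<partial>N)"
    by (intro nn_integral_monotone_convergence_SUP)
       (auto simp: incseq_def le_fun_def intro!: mult_left_mono min.mono)
  finally show ?thesis .
qed

text \<open>By homogeneity, dividing F by A and G by B divides the left side of the hypothesis by c
  = A^(1-l) B^l, so M is multiplied by k = 1/c. Truncation at n makes p and q real valued, and
  monotone convergence removes it.\<close>

lemma one_dim_inequality:
  fixes F G p q M :: "real \<Rightarrow> ennreal" and l :: real
  defines "A \<equiv> \<integral>\<^sup>+s. F s \<partial>lborel" and "B \<equiv> \<integral>\<^sup>+s. G s \<partial>lborel"
  assumes l: "0 < l" "l < 1"
    and [measurable]: "F \<in> borel_measurable borel" "G \<in> borel_measurable borel"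
      "p \<in> borel_measurable borel" "q \<in> borel_measurable borel" "M \<in> borel_measurable borel"
    and A: "0 < A" "A < \<infinity>" and B: "0 < B" "B < \<infinity>"
    and le: "AE z in lborel \<Otimes>\<^sub>M lborel.
      ennreal_pow (F (fst z)) (1 - l) * ennreal_pow (G (snd z)) l *
        (ennreal (1 - l) * p (fst z) + ennreal l * q (snd z)) \<le> M ((1 - l) * fst z + l * snd z)"
  shows "ennreal_pow A (1 - l) * ennreal_pow B l *
      (ennreal (1 - l) * ((\<integral>\<^sup>+s. F s * p s \<partial>lborel) / A) +
       ennreal l * ((\<integral>\<^sup>+s. G s * q s \<partial>lborel) / B)) \<le> (\<integral>\<^sup>+t. M t \<partial>lborel)"
proof -
  define a b where "a = enn2real A" and "b = enn2real B"
  have a: "0 < a" "A = ennreal a" and b: "0 < b" "B = ennreal b"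
    using A B by (auto simp: a_def b_def enn2real_positive_iff less_top)
  define c where "c = a powr (1 - l) * b powr l"
  have c: "0 < c" using a b by (simp add: c_def)
  define k where "k = 1 / c"
  have k: "0 < k" "c * k = 1" using c by (auto simp: k_def)
  have F_fin: "AE s in lborel. F s < \<infinity>"
    using nn_integral_PInf_AE[of F lborel] A(2) by (auto simp: A_def less_top)
  have G_fin: "AE s in lborel. G s < \<infinity>"
    using nn_integral_PInf_AE[of G lborel] B(2) by (auto simp: B_def less_top)
  define F' G' where "F' s = enn2real (F s) / a" and "G' s = enn2real (G s) / b" for s
  have F': "AE s in lborel. ennreal (F' s) = F s / A"
    using F_fin by eventually_elim (use a in \<open>simp add: F'_def divide_ennreal[symmetric] less_top\<close>)
  have G': "AE s in lborel. ennreal (G' s) = G s / B"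
    using G_fin by eventually_elim (use b in \<open>simp add: G'_def divide_ennreal[symmetric] less_top\<close>)
  have [measurable]: "F' \<in> borel_measurable borel" "G' \<in> borel_measurable borel"
    unfolding F'_def G'_def by measurable
  have trunc: "ennreal (enn2real (min x (of_nat n))) = min x (of_nat n)" for x :: ennreal and n :: nat
    by (intro ennreal_enn2real) (simp add: min_less_iff_disj of_nat_less_top)
  have bound: "ennreal c * (ennreal (1 - l) / A * (\<integral>\<^sup>+s. F s * min (p s) (of_nat n) \<partial>lborel) +
      ennreal l / B * (\<integral>\<^sup>+s. G s * min (q s) (of_nat n) \<partial>lborel)) \<le> (\<integral>\<^sup>+t. M t \<partial>lborel)" for n :: nat
  proof -
    define p' q' where "p' s = enn2real (min (p s) (of_nat n))"
      and "q' s = enn2real (min (q s) (of_nat n))" for s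
    have [measurable]: "p' \<in> borel_measurable borel" "q' \<in> borel_measurable borel"
      unfolding p'_def q'_def by measurable
    have int_F: "(\<integral>\<^sup>+s. ennreal (F' s) * ennreal (p' s) \<partial>lborel) =
        (\<integral>\<^sup>+s. F s * min (p s) (of_nat n) \<partial>lborel) / A"
    proof -
      have "(\<integral>\<^sup>+s. ennreal (F' s) * ennreal (p' s) \<partial>lborel) =
          (\<integral>\<^sup>+s. F s * min (p s) (of_nat n) / A \<partial>lborel)"
        using F' by (intro nn_integral_cong_AE, eventually_elim)
          (simp add: p'_def trunc ennreal_divide_times ennreal_times_divide mult.commute)
      then show ?thesis by (simp add: nn_integral_divide)
    qed
    have int_G: "(\<integral>\<^sup>+s. ennreal (G' s) * ennreal (q' s) \<partial>lborel) =
        (\<integral>\<^sup>+s. G s * min (q s) (of_nat n) \<partial>lborel) / B"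
    proof -
      have "(\<integral>\<^sup>+s. ennreal (G' s) * ennreal (q' s) \<partial>lborel) =
          (\<integral>\<^sup>+s. G s * min (q s) (of_nat n) / B \<partial>lborel)"
        using G' by (intro nn_integral_cong_AE, eventually_elim)
          (simp add: q'_def trunc ennreal_divide_times ennreal_times_divide mult.commute)
      then show ?thesis by (simp add: nn_integral_divide)
    qed
    have "ennreal (1 - l) * (\<integral>\<^sup>+s. ennreal (F' s) * ennreal (p' s) \<partial>lborel) +
        ennreal l * (\<integral>\<^sup>+s. ennreal (G' s) * ennreal (q' s) \<partial>lborel) \<le>
        (\<integral>\<^sup>+t. ennreal (k) * M t \<partial>lborel)"
    proof (rule one_dim_inequality_normalized[OF l])
      show "(\<integral>\<^sup>+s. ennreal (F' s) \<partial>lborel) = 1"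
        using F' A by (subst nn_integral_cong_AE[of _ "\<lambda>s. F s / A"])
          (auto simp: nn_integral_divide A_def[symmetric])
      show "(\<integral>\<^sup>+s. ennreal (G' s) \<partial>lborel) = 1"
        using G' B by (subst nn_integral_cong_AE[of _ "\<lambda>s. G s / B"])
          (auto simp: nn_integral_divide B_def[symmetric])
      show "AE z in lborel \<Otimes>\<^sub>M lborel. ennreal (F' (fst z) powr (1 - l) * G' (snd z) powr l *
          ((1 - l) * p' (fst z) + l * q' (snd z))) \<le> ennreal (k) * M ((1 - l) * fst z + l * snd z)"
        using le
      proof eventually_elim
        case (elim z)
        let ?s = "fst z" and ?t = "snd z"
        \<comment> \<open>Only an inequality: \<open>enn2real\<close> sends infinity to 0, while
          \<open>ennreal_pow\<close> keeps it infinite. This direction is the one required.\<close>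
        have pow_le: "ennreal (enn2real x powr e) \<le> ennreal_pow x e" for x e
          by (simp add: ennreal_pow_def)
        have nn: "0 \<le> p' ?s" "0 \<le> q' ?t" by (auto simp: p'_def q'_def)
        have eq: "F' ?s powr (1 - l) * G' ?t powr l * ((1 - l) * p' ?s + l * q' ?t) =
          k * (enn2real (F ?s) powr (1 - l) * enn2real (G ?t) powr l * ((1 - l) * p' ?s + l * q' ?t))"
          using a b by (simp add: F'_def G'_def k_def c_def powr_divide)
        have "ennreal (F' ?s powr (1 - l) * G' ?t powr l * ((1 - l) * p' ?s + l * q' ?t)) =
          ennreal (k) * (ennreal (enn2real (F ?s) powr (1 - l)) * ennreal (enn2real (G ?t) powr l) *
            (ennreal (1 - l) * ennreal (p' ?s) + ennreal l * ennreal (q' ?t)))"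
          unfolding eq using l k nn by (simp add: ennreal_mult)
        also have "\<dots> \<le> ennreal (k) * (ennreal_pow (F ?s) (1 - l) * ennreal_pow (G ?t) l *
            (ennreal (1 - l) * p ?s + ennreal l * q ?t))"
          by (intro mult_left_mono mult_mono add_mono pow_le) (auto simp: p'_def q'_def trunc)
        also have "\<dots> \<le> ennreal (k) * M ((1 - l) * ?s + l * ?t)"
          by (intro mult_left_mono elim) simp
        finally show ?case .
      qed
    qed (auto simp: F'_def G'_def p'_def q'_def intro!: divide_nonneg_pos a b)
    then have "ennreal c * (ennreal (1 - l) * ((\<integral>\<^sup>+s. F s * min (p s) (of_nat n) \<partial>lborel) / A) +
        ennreal l * ((\<integral>\<^sup>+s. G s * min (q s) (of_nat n) \<partial>lborel) / B))
        \<le> ennreal c * (ennreal (k) * (\<integral>\<^sup>+t. M t \<partial>lborel))"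
      by (intro mult_left_mono) (auto simp: int_F int_G nn_integral_cmult)
    also have "ennreal c * (ennreal (k) * (\<integral>\<^sup>+t. M t \<partial>lborel)) = (\<integral>\<^sup>+t. M t \<partial>lborel)"
      using c k by (simp add: mult.assoc[symmetric] ennreal_mult'[symmetric])
    finally show ?thesis
      by (simp add: ennreal_times_divide ennreal_divide_times)
  qed
  have "ennreal_pow A (1 - l) * ennreal_pow B l = ennreal c"
    using a b by (simp add: ennreal_pow_ennreal c_def ennreal_mult')
  moreover have div_comm: "c * (X / D) = c / D * X" for c X D :: ennreal
    by (simp add: ennreal_times_divide ennreal_divide_times)
  have F_p_meas: "F \<in> borel_measurable lborel" "p \<in> borel_measurable lborel"
    "G \<in> borel_measurable lborel" "q \<in> borel_measurable lborel"
    by simp_all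
  have "ennreal (1 - l) * ((\<integral>\<^sup>+s. F s * p s \<partial>lborel) / A) +
       ennreal l * ((\<integral>\<^sup>+s. G s * q s \<partial>lborel) / B) =
      (SUP n. ennreal (1 - l) / A * (\<integral>\<^sup>+s. F s * min (p s) (of_nat n) \<partial>lborel) +
      ennreal l / B * (\<integral>\<^sup>+s. G s * min (q s) (of_nat n) \<partial>lborel))"
  proof (subst ennreal_SUP_add)
    show "incseq (\<lambda>n. ennreal (1 - l) / A * (\<integral>\<^sup>+s. F s * min (p s) (of_nat n) \<partial>lborel))"
      "incseq (\<lambda>n. ennreal l / B * (\<integral>\<^sup>+s. G s * min (q s) (of_nat n) \<partial>lborel))"
      by (auto simp: incseq_def intro!: mult_left_mono nn_integral_mono min.mono)
  qed (simp only: div_comm SUP_mult_left_ennreal[symmetric] nn_integral_mult_truncation[of F lborel p, symmetric]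
      nn_integral_mult_truncation[of G lborel q, symmetric] F_p_meas)
  ultimately show ?thesis
    by (simp add: SUP_mult_left_ennreal) (intro SUP_least bound)
qed

section \<open>Induction on the dimension\<close>

text \<open>The restriction to I makes the result extensional, hence a point of the product space
  \<open>PiM\<close>.\<close>

definition combination :: "'i set \<Rightarrow> real \<Rightarrow> ('i \<Rightarrow> real) \<Rightarrow> ('i \<Rightarrow> real) \<Rightarrow> 'i \<Rightarrow> real" where
  "combination I l x y = (\<lambda>i\<in>I. (1 - l) * x i + l * y i)"

lemma measurable_combination [measurable (raw)]:
  assumes "f \<in> N \<rightarrow>\<^sub>M PiM I (\<lambda>_. lborel)" and "g \<in> N \<rightarrow>\<^sub>M PiM I (\<lambda>_. lborel)"
  shows "(\<lambda>z. combination I l (f z) (g z)) \<in> N \<rightarrow>\<^sub>M PiM I (\<lambda>_. lborel)"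
  unfolding combination_def
proof (rule measurable_restrict)
  fix i assume "i \<in> I"
  then have "(\<lambda>z. f z i) \<in> borel_measurable N" "(\<lambda>z. g z i) \<in> borel_measurable N"
    using measurable_compose[OF assms(1) measurable_component_singleton[of i I "\<lambda>_. lborel"]]
      measurable_compose[OF assms(2) measurable_component_singleton[of i I "\<lambda>_. lborel"]]
    by (simp_all add: comp_def)
  then show "(\<lambda>z. (1 - l) * f z i + l * g z i) \<in> N \<rightarrow>\<^sub>M lborel"
    by simp
qed

lemma combination_upd:
  "i \<notin> I \<Longrightarrow> combination (insert i I) l (x(i := s)) (y(i := t)) =
    (combination I l x y)(i := (1 - l) * s + l * t)"
  by (auto simp: combination_def fun_eq_iff)

interpretation lborel_prod: product_sigma_finite "\<lambda>_. lborel :: real measure" ..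

lemma sigma_finite_PiM_lborel: "finite I \<Longrightarrow> sigma_finite_measure (PiM I (\<lambda>_. lborel :: real measure))"
  by (rule lborel_prod.sigma_finite)

lemma nn_integral_PiM_insert_pair:
  fixes h :: "('i \<Rightarrow> real) \<times> ('i \<Rightarrow> real) \<Rightarrow> ennreal"
  assumes I: "finite I" "i \<notin> I"
    and [measurable]: "h \<in> borel_measurable
      (PiM (insert i I) (\<lambda>_. lborel) \<Otimes>\<^sub>M PiM (insert i I) (\<lambda>_. lborel))"
  shows "(\<integral>\<^sup>+z. h z \<partial>(PiM (insert i I) (\<lambda>_. lborel) \<Otimes>\<^sub>M PiM (insert i I) (\<lambda>_. lborel))) =
    (\<integral>\<^sup>+s. \<integral>\<^sup>+t. \<integral>\<^sup>+z. h ((fst z)(i := s), (snd z)(i := t))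
      \<partial>(PiM I (\<lambda>_. lborel) \<Otimes>\<^sub>M PiM I (\<lambda>_. lborel)) \<partial>lborel \<partial>lborel)"
proof -
  let ?P = "PiM I (\<lambda>_. lborel :: real measure)" and ?P' = "PiM (insert i I) (\<lambda>_. lborel :: real measure)"
  interpret P: sigma_finite_measure ?P using I by (intro sigma_finite_PiM_lborel) 
  interpret P': sigma_finite_measure ?P' using I by (intro sigma_finite_PiM_lborel) simp
  interpret PP': pair_sigma_finite ?P' ?P' ..
  interpret PL: pair_sigma_finite ?P "lborel :: real measure" ..
  have upd [measurable]: "(\<lambda>z. (f z)(i := g z)) \<in> N \<rightarrow>\<^sub>M ?P'"
    if "f \<in> N \<rightarrow>\<^sub>M ?P" "g \<in> borel_measurable N" for f g and N :: "'z measure"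
    using that by (intro measurable_fun_upd[where J=I]) auto
  have "(\<integral>\<^sup>+z. h z \<partial>(?P' \<Otimes>\<^sub>M ?P')) = (\<integral>\<^sup>+X. \<integral>\<^sup>+Y. h (X, Y) \<partial>?P' \<partial>?P')"
    by (rule P'.nn_integral_fst[symmetric]) simp
  also have "\<dots> = (\<integral>\<^sup>+s. \<integral>\<^sup>+x. \<integral>\<^sup>+Y. h (x(i := s), Y) \<partial>?P' \<partial>?P \<partial>lborel)"
    by (rule lborel_prod.product_nn_integral_insert_rev[OF I]) measurable
  also have "\<dots> = (\<integral>\<^sup>+s. \<integral>\<^sup>+x. \<integral>\<^sup>+t. \<integral>\<^sup>+y. h (x(i := s), y(i := t)) \<partial>?P \<partial>lborel \<partial>?P \<partial>lborel)"
  proof (intro nn_integral_cong)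
    fix s and x assume "x \<in> space ?P"
    then have "x(i := s) \<in> space ?P'" by (auto simp: space_PiM PiE_iff extensional_def)
    then have "(\<lambda>Y. h (x(i := s), Y)) \<in> borel_measurable ?P'" by measurable
    then show "(\<integral>\<^sup>+Y. h (x(i := s), Y) \<partial>?P') = (\<integral>\<^sup>+t. \<integral>\<^sup>+y. h (x(i := s), y(i := t)) \<partial>?P \<partial>lborel)"
      by (rule lborel_prod.product_nn_integral_insert_rev[OF I])
  qed
  also have "\<dots> = (\<integral>\<^sup>+s. \<integral>\<^sup>+t. \<integral>\<^sup>+x. \<integral>\<^sup>+y. h (x(i := s), y(i := t)) \<partial>?P \<partial>?P \<partial>lborel \<partial>lborel)"
  proof (intro nn_integral_cong)
    fix s :: real
    have "(\<lambda>(x, t). \<integral>\<^sup>+y. h (x(i := s), y(i := t)) \<partial>?P) \<in> borel_measurable (?P \<Otimes>\<^sub>M lborel)"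
      by measurable
    from PL.Fubini'[OF this]
    show "(\<integral>\<^sup>+x. \<integral>\<^sup>+t. \<integral>\<^sup>+y. h (x(i := s), y(i := t)) \<partial>?P \<partial>lborel \<partial>?P) =
      (\<integral>\<^sup>+t. \<integral>\<^sup>+x. \<integral>\<^sup>+y. h (x(i := s), y(i := t)) \<partial>?P \<partial>?P \<partial>lborel)"
      by simp
  qed
  also have "\<dots> = (\<integral>\<^sup>+s. \<integral>\<^sup>+t. \<integral>\<^sup>+z. h ((fst z)(i := s), (snd z)(i := t)) \<partial>(?P \<Otimes>\<^sub>M ?P) \<partial>lborel \<partial>lborel)"
  proof (intro nn_integral_cong)
    fix s t :: real
    have "(\<lambda>z. h ((fst z)(i := s), (snd z)(i := t))) \<in> borel_measurable (?P \<Otimes>\<^sub>M ?P)"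
      by measurable
    from P.nn_integral_fst[OF this]
    show "(\<integral>\<^sup>+x. \<integral>\<^sup>+y. h (x(i := s), y(i := t)) \<partial>?P \<partial>?P) =
      (\<integral>\<^sup>+z. h ((fst z)(i := s), (snd z)(i := t)) \<partial>(?P \<Otimes>\<^sub>M ?P))"
      by simp
  qed
  finally show ?thesis .
qed

text \<open>Both new coordinates are quantified first, so that for almost every choice of them the
  inner statement is the premise of the induction hypothesis for a pair of slices. Null sets are
  handled as vanishing integrals of an indicator, to which Fubini applies.\<close>

lemma AE_PiM_insert_pair:
  fixes Q :: "('i \<Rightarrow> real) \<times> ('i \<Rightarrow> real) \<Rightarrow> bool"
  assumes I: "finite I" "i \<notin> I"
    and [measurable]: "Measurable.pred
      (PiM (insert i I) (\<lambda>_. lborel :: real measure) \<Otimes>\<^sub>M PiM (insert i I) (\<lambda>_. lborel)) Q"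
    and AE: "AE z in PiM (insert i I) (\<lambda>_. lborel) \<Otimes>\<^sub>M PiM (insert i I) (\<lambda>_. lborel). Q z"
  shows "AE s in lborel. AE t in lborel. AE z in PiM I (\<lambda>_. lborel) \<Otimes>\<^sub>M PiM I (\<lambda>_. lborel).
    Q ((fst z)(i := s), (snd z)(i := t))"
proof -
  let ?P = "PiM I (\<lambda>_. lborel :: real measure)" and ?P' = "PiM (insert i I) (\<lambda>_. lborel :: real measure)"
  interpret P: sigma_finite_measure ?P using I by (intro sigma_finite_PiM_lborel)
  interpret PP: pair_sigma_finite ?P ?P ..
  have upd [measurable]: "(\<lambda>z. (f z)(i := g z)) \<in> N \<rightarrow>\<^sub>M ?P'"
    if "f \<in> N \<rightarrow>\<^sub>M ?P" "g \<in> borel_measurable N" for f g and N :: "'z measure"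
    using that by (intro measurable_fun_upd[where J=I]) auto
  define h :: "('i \<Rightarrow> real) \<times> ('i \<Rightarrow> real) \<Rightarrow> ennreal" where "h z = indicator {z. \<not> Q z} z" for z
  have h [measurable]: "h \<in> borel_measurable (?P' \<Otimes>\<^sub>M ?P')"
    unfolding h_def by measurable
  have h_0: "h z = 0 \<longleftrightarrow> Q z" for z
    by (simp add: h_def indicator_def)
  have "(\<integral>\<^sup>+z. h z \<partial>(?P' \<Otimes>\<^sub>M ?P')) = 0"
    by (subst nn_integral_0_iff_AE) (use AE in \<open>auto simp: h_0\<close>)
  then have "(\<integral>\<^sup>+s. \<integral>\<^sup>+t. \<integral>\<^sup>+z. h ((fst z)(i := s), (snd z)(i := t)) \<partial>(?P \<Otimes>\<^sub>M ?P) \<partial>lborel \<partial>lborel) = 0"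
    by (subst (asm) nn_integral_PiM_insert_pair[OF I]) simp_all
  then have "AE s in lborel. (\<integral>\<^sup>+t. \<integral>\<^sup>+z. h ((fst z)(i := s), (snd z)(i := t)) \<partial>(?P \<Otimes>\<^sub>M ?P) \<partial>lborel) = 0"
    by (subst (asm) nn_integral_0_iff_AE) (simp_all, measurable)
  then show ?thesis
  proof (rule eventually_mono)
    fix s
    assume "(\<integral>\<^sup>+t. \<integral>\<^sup>+z. h ((fst z)(i := s), (snd z)(i := t)) \<partial>(?P \<Otimes>\<^sub>M ?P) \<partial>lborel) = 0"
    then have "AE t in lborel. (\<integral>\<^sup>+z. h ((fst z)(i := s), (snd z)(i := t)) \<partial>(?P \<Otimes>\<^sub>M ?P)) = 0"
      by (subst (asm) nn_integral_0_iff_AE) (simp_all, measurable)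
    then show "AE t in lborel. AE z in ?P \<Otimes>\<^sub>M ?P. Q ((fst z)(i := s), (snd z)(i := t))"
    proof (rule eventually_mono)
      fix t
      assume "(\<integral>\<^sup>+z. h ((fst z)(i := s), (snd z)(i := t)) \<partial>(?P \<Otimes>\<^sub>M ?P)) = 0"
      then show "AE z in ?P \<Otimes>\<^sub>M ?P. Q ((fst z)(i := s), (snd z)(i := t))"
        by (subst (asm) nn_integral_0_iff_AE) (simp_all add: h_0)
    qed
  qed
qed

text \<open>Induction on the index set: the induction hypothesis on slices is exactly the premise of
  \<open>one_dim_inequality\<close> for the slice masses \<open>F1\<close>, \<open>G1\<close> and
  the weighted means \<open>FP / F1\<close>, \<open>GQ / G1\<close>.\<close>

lemma PiM_inequality:
  fixes F G p q M :: "('i \<Rightarrow> real) \<Rightarrow> ennreal" and l :: real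
  assumes l: "0 < l" "l < 1" and "finite I"
    and "F \<in> borel_measurable (PiM I (\<lambda>_. lborel))" "G \<in> borel_measurable (PiM I (\<lambda>_. lborel))"
      "p \<in> borel_measurable (PiM I (\<lambda>_. lborel))" "q \<in> borel_measurable (PiM I (\<lambda>_. lborel))"
      "M \<in> borel_measurable (PiM I (\<lambda>_. lborel))"
    and "0 < (\<integral>\<^sup>+x. F x \<partial>PiM I (\<lambda>_. lborel))" "(\<integral>\<^sup>+x. F x \<partial>PiM I (\<lambda>_. lborel)) < \<infinity>"
    and "0 < (\<integral>\<^sup>+x. G x \<partial>PiM I (\<lambda>_. lborel))" "(\<integral>\<^sup>+x. G x \<partial>PiM I (\<lambda>_. lborel)) < \<infinity>"
    and "AE z in PiM I (\<lambda>_. lborel) \<Otimes>\<^sub>M PiM I (\<lambda>_. lborel).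
      ennreal_pow (F (fst z)) (1 - l) * ennreal_pow (G (snd z)) l *
        (ennreal (1 - l) * p (fst z) + ennreal l * q (snd z)) \<le> M (combination I l (fst z) (snd z))"
  shows "ennreal_pow (\<integral>\<^sup>+x. F x \<partial>PiM I (\<lambda>_. lborel)) (1 - l) *
      ennreal_pow (\<integral>\<^sup>+x. G x \<partial>PiM I (\<lambda>_. lborel)) l *
      (ennreal (1 - l) * ((\<integral>\<^sup>+x. F x * p x \<partial>PiM I (\<lambda>_. lborel)) / (\<integral>\<^sup>+x. F x \<partial>PiM I (\<lambda>_. lborel))) +
       ennreal l * ((\<integral>\<^sup>+x. G x * q x \<partial>PiM I (\<lambda>_. lborel)) / (\<integral>\<^sup>+x. G x \<partial>PiM I (\<lambda>_. lborel))))
    \<le> (\<integral>\<^sup>+x. M x \<partial>PiM I (\<lambda>_. lborel))"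
  using assms(3-)
proof (induction I arbitrary: F G p q M rule: finite_induct)
  case empty
  let ?P = "PiM {} (\<lambda>_::'i. lborel :: real measure)" and ?o = "\<lambda>_::'i. undefined :: real"
  interpret P: sigma_finite_measure ?P by (intro sigma_finite_PiM_lborel) simp
  interpret PP: pair_sigma_finite ?P ?P ..
  \<comment> \<open>The empty product is the unit mass at the undefined function. Almost everywhere
    then means at this single point, and the weighted means are the values of p and q there.\<close>
  have int: "(\<integral>\<^sup>+x. h x \<partial>?P) = h ?o" for h
    by (simp add: PiM_empty nn_integral_count_space_finite)
  have AE_pt: "(AE x in ?P. R x) \<longleftrightarrow> R ?o" for R
    unfolding PiM_empty by (simp add: AE_count_space)
  have "ennreal_pow (F ?o) (1 - l) * ennreal_pow (G ?o) l * (ennreal (1 - l) * p ?o + ennreal l * q ?o)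
      \<le> M (combination {} l ?o ?o)"
    using PP.AE_pair[OF empty(10)] by (simp add: AE_pt)
  moreover have "combination {} l ?o ?o = ?o"
    by (simp add: combination_def restrict_def)
  ultimately show ?case
    using empty(6-9) by (simp add: int ennreal_mult_divide_eq mult.commute[of "F _"] mult.commute[of "G _"])
next
  case (insert i I)
  let ?P = "PiM I (\<lambda>_. lborel :: real measure)" and ?P' = "PiM (insert i I) (\<lambda>_. lborel :: real measure)"
  note I = insert(1,2)
  note [measurable] = insert(4-8)
  interpret P: sigma_finite_measure ?P using I by (intro sigma_finite_PiM_lborel)
  have upd [measurable]: "(\<lambda>z. (f z)(i := g z)) \<in> N \<rightarrow>\<^sub>M ?P'"
    if "f \<in> N \<rightarrow>\<^sub>M ?P" "g \<in> borel_measurable N" for f g and N :: "'z measure"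
    using that by (intro measurable_fun_upd[where J=I]) auto
  have split: "(\<integral>\<^sup>+X. h X \<partial>?P') = (\<integral>\<^sup>+s. \<integral>\<^sup>+x. h (x(i := s)) \<partial>?P \<partial>lborel)"
    if "h \<in> borel_measurable ?P'" for h
    by (rule lborel_prod.product_nn_integral_insert_rev[OF I that])
  have slice: "(\<lambda>x. h (x(i := r))) \<in> borel_measurable ?P"
    if [measurable]: "h \<in> borel_measurable ?P'" for h :: "('i \<Rightarrow> real) \<Rightarrow> ennreal" and r
    by measurable
  define F1 G1 M1 FP GQ where "F1 s = (\<integral>\<^sup>+x. F (x(i := s)) \<partial>?P)" and "G1 s = (\<integral>\<^sup>+x. G (x(i := s)) \<partial>?P)"
    and "M1 s = (\<integral>\<^sup>+x. M (x(i := s)) \<partial>?P)"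
    and "FP s = (\<integral>\<^sup>+x. F (x(i := s)) * p (x(i := s)) \<partial>?P)"
    and "GQ s = (\<integral>\<^sup>+x. G (x(i := s)) * q (x(i := s)) \<partial>?P)" for s
  have [measurable]: "F1 \<in> borel_measurable borel" "G1 \<in> borel_measurable borel"
    "M1 \<in> borel_measurable borel" "FP \<in> borel_measurable borel" "GQ \<in> borel_measurable borel"
    unfolding F1_def G1_def M1_def FP_def GQ_def by measurable
  have ints: "(\<integral>\<^sup>+X. F X \<partial>?P') = (\<integral>\<^sup>+s. F1 s \<partial>lborel)" "(\<integral>\<^sup>+X. G X \<partial>?P') = (\<integral>\<^sup>+s. G1 s \<partial>lborel)"
    "(\<integral>\<^sup>+X. M X \<partial>?P') = (\<integral>\<^sup>+s. M1 s \<partial>lborel)"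
    "(\<integral>\<^sup>+X. F X * p X \<partial>?P') = (\<integral>\<^sup>+s. FP s \<partial>lborel)"
    "(\<integral>\<^sup>+X. G X * q X \<partial>?P') = (\<integral>\<^sup>+s. GQ s \<partial>lborel)"
    unfolding F1_def G1_def M1_def FP_def GQ_def by (rule split; measurable)+
  note pos_fin = insert(9-12)[unfolded ints]
  have F1_fin: "AE s in lborel. F1 s < \<infinity>"
    using nn_integral_PInf_AE[of F1 lborel] pos_fin(2) by (auto simp: less_top)
  have G1_fin: "AE s in lborel. G1 s < \<infinity>"
    using nn_integral_PInf_AE[of G1 lborel] pos_fin(4) by (auto simp: less_top)
  have quot: "(\<integral>\<^sup>+s. f s * (h s / f s) \<partial>lborel) = (\<integral>\<^sup>+s. h s \<partial>lborel)"
    if "AE s in lborel. f s < \<infinity>" "\<And>s. f s = 0 \<Longrightarrow> h s = 0" for f h :: "real \<Rightarrow> ennreal"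
    using that(1)
  proof (intro nn_integral_cong_AE, eventually_elim)
    case (elim s)
    then show ?case
      using that(2)[of s] by (cases "f s = 0") (auto simp: ennreal_times_divide mult.commute[of "f s"] ennreal_mult_divide_eq)
  qed
  have zero: "(\<integral>\<^sup>+x. f x * h x \<partial>?P) = 0"
    if "(\<integral>\<^sup>+x. f x \<partial>?P) = 0" "f \<in> borel_measurable ?P" "h \<in> borel_measurable ?P" for f h
    using that by (auto simp: nn_integral_0_iff_AE)
  have FP0: "FP s = 0" if "F1 s = 0" for s
    using that unfolding F1_def FP_def by (rule zero) measurable
  have GQ0: "GQ s = 0" if "G1 s = 0" for s
    using that unfolding G1_def GQ_def by (rule zero) measurable
  have "Measurable.pred (?P' \<Otimes>\<^sub>M ?P') (\<lambda>z. ennreal_pow (F (fst z)) (1 - l) * ennreal_pow (G (snd z)) l *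
      (ennreal (1 - l) * p (fst z) + ennreal l * q (snd z)) \<le> M (combination (insert i I) l (fst z) (snd z)))"
    by measurable
  note AE_PiM_insert_pair[OF I this insert(13), unfolded fst_conv snd_conv]
  then have "AE s in lborel. AE t in lborel. AE z in ?P \<Otimes>\<^sub>M ?P.
      ennreal_pow (F ((fst z)(i := s))) (1 - l) * ennreal_pow (G ((snd z)(i := t))) l *
        (ennreal (1 - l) * p ((fst z)(i := s)) + ennreal l * q ((snd z)(i := t)))
      \<le> M (combination (insert i I) l ((fst z)(i := s)) ((snd z)(i := t)))"
    by assumption
  then have "AE s in lborel. AE t in lborel.
      ennreal_pow (F1 s) (1 - l) * ennreal_pow (G1 t) l *
        (ennreal (1 - l) * (FP s / F1 s) + ennreal l * (GQ t / G1 t)) \<le> M1 ((1 - l) * s + l * t)"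
    using F1_fin
  proof eventually_elim
    case s: (elim s)
    show ?case
      using s(1) G1_fin
    proof eventually_elim
      case t: (elim t)
      show ?case
      \<comment> \<open>If a slice has mass 0, the induction hypothesis does not apply, but the left
        side is 0 because \<open>ennreal_pow 0\<close> is 0 and 0 annihilates infinity.\<close>
      proof (cases "F1 s = 0 \<or> G1 t = 0")
        case False
        then show ?thesis
          unfolding F1_def G1_def M1_def FP_def GQ_def
        proof (intro insert.IH slice insert(4-8))
          show "AE z in ?P \<Otimes>\<^sub>M ?P.
            ennreal_pow (F ((fst z)(i := s))) (1 - l) * ennreal_pow (G ((snd z)(i := t))) l *
              (ennreal (1 - l) * p ((fst z)(i := s)) + ennreal l * q ((snd z)(i := t)))
            \<le> M ((combination I l (fst z) (snd z))(i := (1 - l) * s + l * t))"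
            using t(1) unfolding combination_upd[OF I(2)] .
        qed (use False s(2) t(2) in \<open>simp_all add: F1_def G1_def zero_less_iff_neq_zero del: fun_upd_apply\<close>)
      qed auto
    qed
  qed
  note AE_st = this
  have fst_m: "fst \<in> borel_measurable (lborel \<Otimes>\<^sub>M lborel :: (real \<times> real) measure)"
    and snd_m: "snd \<in> borel_measurable (lborel \<Otimes>\<^sub>M lborel :: (real \<times> real) measure)"
    using measurable_fst[of "lborel :: real measure" "lborel :: real measure"]
      measurable_snd[of "lborel :: real measure" "lborel :: real measure"] by simp_all
  have comp_m: "(\<lambda>z. h (fst z)) \<in> borel_measurable (lborel \<Otimes>\<^sub>M lborel)"
    "(\<lambda>z. h (snd z)) \<in> borel_measurable (lborel \<Otimes>\<^sub>M lborel)"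
    "(\<lambda>z. h ((1 - l) * fst z + l * snd z)) \<in> borel_measurable (lborel \<Otimes>\<^sub>M lborel)"
    if "h \<in> borel_measurable borel" for h :: "real \<Rightarrow> ennreal"
    using fst_m snd_m
    by (auto intro!: measurable_compose[OF _ that] borel_measurable_add borel_measurable_times)
  have AE_z: "AE z in lborel \<Otimes>\<^sub>M lborel.
      ennreal_pow (F1 (fst z)) (1 - l) * ennreal_pow (G1 (snd z)) l *
        (ennreal (1 - l) * (FP (fst z) / F1 (fst z)) + ennreal l * (GQ (snd z) / G1 (snd z)))
        \<le> M1 ((1 - l) * fst z + l * snd z)"
  proof (rule lborel_pair.AE_pair_measure)
    show "{z \<in> space (lborel \<Otimes>\<^sub>M lborel).
      ennreal_pow (F1 (fst z)) (1 - l) * ennreal_pow (G1 (snd z)) l *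
        (ennreal (1 - l) * (FP (fst z) / F1 (fst z)) + ennreal l * (GQ (snd z) / G1 (snd z)))
        \<le> M1 ((1 - l) * fst z + l * snd z)} \<in> sets (lborel \<Otimes>\<^sub>M lborel)"
      by (intro borel_measurable_le borel_measurable_times_ennreal borel_measurable_add
          borel_measurable_divide_ennreal measurable_ennreal_pow comp_m borel_measurable_const) simp_all
  qed (use AE_st in \<open>simp only: fst_conv snd_conv\<close>)
  have quot_F: "(\<integral>\<^sup>+s. F1 s * (FP s / F1 s) \<partial>lborel) = (\<integral>\<^sup>+s. FP s \<partial>lborel)"
    by (rule quot[OF F1_fin]) (rule FP0)
  have quot_G: "(\<integral>\<^sup>+s. G1 s * (GQ s / G1 s) \<partial>lborel) = (\<integral>\<^sup>+s. GQ s \<partial>lborel)"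
    by (rule quot[OF G1_fin]) (rule GQ0)
  from one_dim_inequality[OF l _ _ _ _ _ pos_fin AE_z]
  show ?case
    unfolding ints by (simp add: quot_F quot_G)
qed

section \<open>Lines orthogonal to the hyperplane\<close>

text \<open>For compact K1 and K2 choose a in A above K1 and b in B below K2. Then (1-l) K1 + l b
  lies to the left of c = (1-l) a + l b, (1-l) a + l K2 lies to its right, and both are contained in
  C. The possibly non-measurable A and B provide the points a and b; only their Borel subsets are
  measured.\<close>

lemma brunn_minkowski_line:
  fixes A B A0 B0 C :: "real set"
  assumes l: "0 < l" "l < 1" and ne: "A \<noteq> {}" "B \<noteq> {}"
    and sub: "A0 \<subseteq> A" "B0 \<subseteq> B" and sets: "A0 \<in> sets borel" "B0 \<in> sets borel" "C \<in> sets borel"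
    and C: "\<And>a b. a \<in> A \<Longrightarrow> b \<in> B \<Longrightarrow> (1 - l) * a + l * b \<in> C"
  shows "ennreal (1 - l) * emeasure lborel A0 + ennreal l * emeasure lborel B0 \<le> emeasure lborel C"
proof -
  \<comment> \<open>If K is empty, any point of S serves. This is how an empty A0 or B0 is covered,
    and it is why A and B have to be nonempty.\<close>
  have ext: "\<exists>a\<in>S. \<forall>k\<in>K. k \<le> a" "\<exists>b\<in>S. \<forall>k\<in>K. b \<le> k" if "compact K" "K \<subseteq> S" "S \<noteq> {}" for K S :: "real set"
    using that compact_attains_sup[of K] compact_attains_inf[of K] by (cases "K = {}"; blast)+
  have compact: "ennreal (1 - l) * emeasure lborel K1 + ennreal l * emeasure lborel K2 \<le> emeasure lborel C"
    if K: "compact K1" "K1 \<subseteq> A" "compact K2" "K2 \<subseteq> B" for K1 K2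
  proof -
    obtain a where a: "a \<in> A" "\<And>k. k \<in> K1 \<Longrightarrow> k \<le> a" using ext(1)[OF K(1,2) ne(1)] by blast
    obtain b where b: "b \<in> B" "\<And>k. k \<in> K2 \<Longrightarrow> b \<le> k" using ext(2)[OF K(3,4) ne(2)] by blast
    define c where "c = (1 - l) * a + l * b"
    have scale: "emeasure lborel S = ennreal e * (\<integral>\<^sup>+t. indicator S (d + e * t) \<partial>lborel)"
      if "S \<in> sets borel" "0 < e" for S and d e :: real
      using nn_integral_real_affine[of "indicator S" e d] that by simp
    have le: "ennreal (1 - l) * emeasure lborel K1 + ennreal l * emeasure lborel K2 \<le>
      emeasure lborel (C \<inter> {..c}) + emeasure lborel (C \<inter> {c<..})"
    proof (rule add_mono)
      show "ennreal (1 - l) * emeasure lborel K1 \<le> emeasure lborel (C \<inter> {..c})"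
      proof -
        have "(\<integral>\<^sup>+t. indicator K1 t \<partial>lborel) \<le> (\<integral>\<^sup>+t. indicator (C \<inter> {..c}) (l * b + (1 - l) * t) \<partial>lborel)"
        proof (intro nn_integral_mono)
          fix t
          have "(1 - l) * t \<le> (1 - l) * a" if "t \<in> K1"
            using a(2)[OF that] l by (intro mult_left_mono) auto
          then show "indicator K1 t \<le> (indicator (C \<inter> {..c}) (l * b + (1 - l) * t) :: ennreal)"
            using C[of t b] K(2) b(1) by (auto simp: indicator_def c_def add.commute)
        qed
        then show ?thesis
          using K(1) l sets by (subst scale[of _ "1 - l" "l * b"]) (auto intro!: mult_left_mono simp: borel_compact)
      qed
      show "ennreal l * emeasure lborel K2 \<le> emeasure lborel (C \<inter> {c<..})"
      proof -
        have "(\<integral>\<^sup>+t. indicator K2 t \<partial>lborel) \<le> (\<integral>\<^sup>+t. indicator (C \<inter> {c<..}) ((1 - l) * a + l * t) \<partial>lborel)"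
        \<comment> \<open>The point t = b would be sent to c, which belongs to the left half;
          discarding this one point keeps the halves disjoint.\<close>
        proof (rule nn_integral_mono_AE, use AE_lborel_singleton[of b] in eventually_elim)
          case (elim t)
          have "l * b < l * t" if "t \<in> K2"
            using b(2)[OF that] elim l by auto
          then show "indicator K2 t \<le> (indicator (C \<inter> {c<..}) ((1 - l) * a + l * t) :: ennreal)"
            using C[of a t] K(4) a(1) by (auto simp: indicator_def c_def)
        qed
        then show ?thesis
          using K(3) l sets by (subst scale[of _ l "(1 - l) * a"]) (auto intro!: mult_left_mono simp: borel_compact)
      qed
    qed
    have "emeasure lborel (C \<inter> {..c}) + emeasure lborel (C \<inter> {c<..}) = emeasure lborel C"
    proof -
      have "C \<inter> {..c} \<union> C \<inter> {c<..} = C" "C \<inter> {..c} \<inter> (C \<inter> {c<..}) = {}" by auto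
      moreover have "C \<inter> {..c} \<in> sets lborel" "C \<inter> {c<..} \<in> sets lborel"
        using sets(3) by simp_all
      ultimately show ?thesis
        using plus_emeasure[of "C \<inter> {..c}" lborel "C \<inter> {c<..}"] by metis
    qed
    with le show ?thesis by (simp only:)
  qed
  have bounded: "ennreal (1 - l) * emeasure lborel S + ennreal l * emeasure lborel T \<le> emeasure lborel C"
    if S: "S \<in> sets borel" "bounded S" "S \<subseteq> A" and T: "T \<in> sets borel" "bounded T" "T \<subseteq> B" for S T
  proof (rule ennreal_le_epsilon)
    fix e :: real assume e: "0 < e"
    have approx: "\<exists>K. compact K \<and> K \<subseteq> R \<and> emeasure lborel R \<le> emeasure lborel K + ennreal e"
      if R: "R \<in> sets borel" "bounded R" for R :: "real set"
    proof (rule sets_lebesgue_inner_closed[of R e])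
      fix K assume K: "closed K" "K \<subseteq> R" "emeasure lebesgue (R - K) < ennreal e"
      have "emeasure lborel R \<le> emeasure lborel (K \<union> (R - K))"
        using R K by (intro emeasure_mono) auto
      also have "\<dots> \<le> emeasure lborel K + emeasure lborel (R - K)"
        using R K by (intro emeasure_subadditive) auto
      also have "\<dots> \<le> emeasure lborel K + ennreal e"
        using R K by (intro add_left_mono) auto
      finally show ?thesis
        using K R bounded_subset[OF R(2) K(2)] by (auto simp: compact_eq_bounded_closed)
    qed (use R e in auto)
    obtain K1 where K1: "compact K1" "K1 \<subseteq> S" "emeasure lborel S \<le> emeasure lborel K1 + ennreal e"
      using approx[OF S(1,2)] by blast
    obtain K2 where K2: "compact K2" "K2 \<subseteq> T" "emeasure lborel T \<le> emeasure lborel K2 + ennreal e"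
      using approx[OF T(1,2)] by blast
    have "ennreal (1 - l) * emeasure lborel S + ennreal l * emeasure lborel T \<le>
        ennreal (1 - l) * (emeasure lborel K1 + ennreal e) + ennreal l * (emeasure lborel K2 + ennreal e)"
      by (intro add_mono mult_left_mono K1 K2) auto
    also have "\<dots> = (ennreal (1 - l) * emeasure lborel K1 + ennreal l * emeasure lborel K2) +
        (ennreal (1 - l) + ennreal l) * ennreal e"
      by (simp only: distrib_left distrib_right ac_simps)
    also have "ennreal (1 - l) + ennreal l = 1"
      using l by (subst ennreal_plus[symmetric]) auto
    also have "(ennreal (1 - l) * emeasure lborel K1 + ennreal l * emeasure lborel K2) \<le> emeasure lborel C"
      using K1 K2 S T by (intro compact) auto
    finally show "ennreal (1 - l) * emeasure lborel S + ennreal l * emeasure lborel T \<le> emeasure lborel C + ennreal e"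
      by (simp add: add_right_mono)
  qed
  have exhaust: "emeasure lborel S = (SUP n::nat. emeasure lborel (S \<inter> {- real n..real n}))"
    if "S \<in> sets borel" for S :: "real set"
  proof (subst SUP_emeasure_incseq)
    have "\<exists>n::nat. - real n \<le> t \<and> t \<le> real n" for t
      using real_arch_simple[of "\<bar>t\<bar>"] unfolding abs_le_iff by (metis minus_le_iff)
    then have "(\<Union>n::nat. S \<inter> {- real n..real n}) = S" by auto
    then show "emeasure lborel S = emeasure lborel (\<Union>n::nat. S \<inter> {- real n..real n})" by simp
  qed (use that in \<open>auto simp: incseq_def\<close>)
  have "ennreal (1 - l) * emeasure lborel A0 + ennreal l * emeasure lborel B0 =
    (SUP n::nat. ennreal (1 - l) * emeasure lborel (A0 \<inter> {- real n..real n}) +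
      ennreal l * emeasure lborel (B0 \<inter> {- real n..real n}))"
  proof (subst ennreal_SUP_add)
    show "incseq (\<lambda>n::nat. ennreal (1 - l) * emeasure lborel (A0 \<inter> {- real n..real n}))"
      "incseq (\<lambda>n::nat. ennreal l * emeasure lborel (B0 \<inter> {- real n..real n}))"
      using sets by (auto simp: incseq_def intro!: mult_left_mono emeasure_mono)
  qed (simp only: SUP_mult_left_ennreal[symmetric] exhaust[OF sets(1), symmetric] exhaust[OF sets(2), symmetric])
  also have "\<dots> \<le> emeasure lborel C"
    using sets sub by (intro SUP_least bounded) (auto intro: bounded_subset[OF bounded_closed_interval])
  finally show ?thesis .
qed

text \<open>Layer-cake formula cut off at height 1. Below that height the level sets relative to a
  supremum are nonempty, as the Brunn-Minkowski inequality requires.\<close>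

lemma nn_integral_min_1_eq:
  fixes f :: "real \<Rightarrow> ennreal"
  assumes [measurable]: "f \<in> borel_measurable borel"
  shows "(\<integral>\<^sup>+s. min 1 (f s) \<partial>lborel) =
    (\<integral>\<^sup>+r. indicator {0<..<1} r * emeasure lborel {s. ennreal r \<le> f s} \<partial>lborel)"
proof -
  have len: "min 1 z = (\<integral>\<^sup>+r. indicator {0<..<1::real} r * indicator {r. ennreal r \<le> z} r \<partial>lborel)"
    for z :: ennreal
  proof (cases "1 \<le> z")
    case True
    have "indicator {0<..<1} r * indicator {r. ennreal r \<le> z} r = (indicator {0<..<1} r :: ennreal)" for r :: real
      using True order_trans[of "ennreal r" 1 z] by (auto simp: indicator_def)
    then show ?thesis using True by simp
  next
    case False
    then obtain x where x: "z = ennreal x" "0 \<le> x" "x < 1"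
      by (cases z) (auto simp: not_le)
    then have "indicator {0<..<1} r * indicator {r. ennreal r \<le> z} r = (indicator {0<..x} r :: ennreal)" for r :: real
      by (auto simp: indicator_def)
    then show ?thesis using False x by simp
  qed
  have "(\<integral>\<^sup>+s. min 1 (f s) \<partial>lborel) =
      (\<integral>\<^sup>+s. \<integral>\<^sup>+r. indicator {0<..<1::real} r * indicator {r. ennreal r \<le> f s} r \<partial>lborel \<partial>lborel)"
    by (simp add: len)
  also have "\<dots> = (\<integral>\<^sup>+s. \<integral>\<^sup>+r. indicator {0<..<1::real} r * indicator {z. ennreal (snd z) \<le> f (fst z)} (s, r) \<partial>lborel \<partial>lborel)"
    by (simp add: indicator_def)
  also have "\<dots> = (\<integral>\<^sup>+r. \<integral>\<^sup>+s. indicator {0<..<1::real} r * indicator {z. ennreal (snd z) \<le> f (fst z)} (s, r) \<partial>lborel \<partial>lborel)"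
    by (rule lborel_pair.Fubini'[symmetric]) simp
  also have "\<dots> = (\<integral>\<^sup>+r. indicator {0<..<1} r * emeasure lborel {s. ennreal r \<le> f s} \<partial>lborel)"
  proof (intro nn_integral_cong)
    fix r :: real
    have "(\<integral>\<^sup>+s. indicator {0<..<1::real} r * indicator {z. ennreal (snd z) \<le> f (fst z)} (s, r) \<partial>lborel) =
      indicator {0<..<1} r * (\<integral>\<^sup>+s. indicator {s. ennreal r \<le> f s} s \<partial>lborel)"
      by (subst nn_integral_cmult[symmetric]) (auto intro!: nn_integral_cong simp: indicator_def)
    then show "(\<integral>\<^sup>+s. indicator {0<..<1::real} r * indicator {z. ennreal (snd z) \<le> f (fst z)} (s, r) \<partial>lborel) =
      indicator {0<..<1} r * emeasure lborel {s. ennreal r \<le> f s}"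
      by simp
  qed
  finally show ?thesis .
qed

lemma ennreal_pow_mono: "x \<le> y \<Longrightarrow> 0 \<le> e \<Longrightarrow> ennreal_pow x e \<le> ennreal_pow y e"
  by (auto simp: ennreal_pow_def top_unique less_top intro!: ennreal_leI powr_mono2 enn2real_mono)

lemma ennreal_pow_mult:
  assumes "0 \<le> r" "x < \<infinity>"
  shows "ennreal_pow (ennreal r * x) e = ennreal (r powr e) * ennreal_pow x e"
proof (cases x)
  case (real y)
  then show ?thesis
    using assms(1) by (simp add: ennreal_mult[symmetric] ennreal_pow_ennreal powr_mult)
qed (use assms in simp)

text \<open>For 0 < r < 1 the sets where \<phi> \<ge> r X and \<psi> \<ge> r Y are nonempty, and
  since (r X)^(1-l) (r Y)^l = r c with c = X^(1-l) Y^l, their combination lies in the set where m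
  \<ge> r c. Comparing equal relative levels produces an arithmetic mean of the normalized
  integrals. The suprema belong to \<phi> and \<psi>, the integrals to their Borel
  minorants.\<close>

lemma fibre_inequality:
  fixes \<phi> \<psi> \<phi>0 \<psi>0 m :: "real \<Rightarrow> ennreal"
  defines "X \<equiv> SUP s. \<phi> s" and "Y \<equiv> SUP s. \<psi> s"
  assumes l: "0 < l" "l < 1"
    and [measurable]: "\<phi>0 \<in> borel_measurable borel" "\<psi>0 \<in> borel_measurable borel" "m \<in> borel_measurable borel"
    and le: "\<And>s. \<phi>0 s \<le> \<phi> s" "\<And>s. \<psi>0 s \<le> \<psi> s"
    and m: "\<And>s t. ennreal_pow (\<phi> s) (1 - l) * ennreal_pow (\<psi> t) l \<le> m ((1 - l) * s + l * t)"
    and X: "0 < X" "X < \<infinity>" and Y: "0 < Y" "Y < \<infinity>"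
  shows "ennreal_pow X (1 - l) * ennreal_pow Y l *
    (ennreal (1 - l) * ((\<integral>\<^sup>+s. \<phi>0 s \<partial>lborel) / X) + ennreal l * ((\<integral>\<^sup>+s. \<psi>0 s \<partial>lborel) / Y))
    \<le> (\<integral>\<^sup>+s. m s \<partial>lborel)"
proof -
  obtain x where x: "X = ennreal x" "0 < x"
    using X by (cases X) (auto simp: zero_less_iff_neq_zero)
  obtain y where y: "Y = ennreal y" "0 < y"
    using Y by (cases Y) (auto simp: zero_less_iff_neq_zero)
  define c where "c = x powr (1 - l) * y powr l"
  have c: "0 < c" using x y by (simp add: c_def)
  have c_eq: "ennreal_pow X (1 - l) * ennreal_pow Y l = ennreal c"
    using x y by (simp add: ennreal_pow_ennreal c_def ennreal_mult')
  have le_1: "\<phi>0 s / X \<le> 1" "\<psi>0 s / Y \<le> 1" for s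
    using order_trans[OF le(1)[of s] SUP_upper[of s UNIV \<phi>]] order_trans[OF le(2)[of s] SUP_upper[of s UNIV \<psi>]]
      X Y by (auto simp: X_def[symmetric] Y_def[symmetric] divide_le_posI_ennreal)
  have levels: "ennreal (1 - l) * emeasure lborel {s. ennreal r \<le> \<phi>0 s / X} +
      ennreal l * emeasure lborel {s. ennreal r \<le> \<psi>0 s / Y} \<le> emeasure lborel {s. ennreal r \<le> m s / ennreal c}"
    if r: "0 < r" "r < 1" for r
  proof (rule brunn_minkowski_line[OF l, of "{s. ennreal r * X \<le> \<phi> s}" "{s. ennreal r * Y \<le> \<psi> s}"])
    have "ennreal r * X < X" "ennreal r * Y < Y"
      using r x y by (auto simp: ennreal_mult[symmetric] ennreal_less_iff)
    then have "\<exists>s. ennreal r * X < \<phi> s" "\<exists>s. ennreal r * Y < \<psi> s"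
      by (auto simp: X_def Y_def less_SUP_iff)
    then show "{s. ennreal r * X \<le> \<phi> s} \<noteq> {}" "{s. ennreal r * Y \<le> \<psi> s} \<noteq> {}"
      by (auto intro: less_imp_le)
    have div: "ennreal r * ennreal d \<le> u" if "ennreal r \<le> u / ennreal d" "0 < d" for u d
    proof -
      have "ennreal r * ennreal d \<le> u / ennreal d * ennreal d"
        using that(1) by (rule mult_right_mono) simp
      also have "\<dots> = u"
        using that(2) by (simp add: ennreal_divide_times ennreal_mult_divide_eq)
      finally show ?thesis .
    qed
    show "{s. ennreal r \<le> \<phi>0 s / X} \<subseteq> {s. ennreal r * X \<le> \<phi> s}"
      "{s. ennreal r \<le> \<psi>0 s / Y} \<subseteq> {s. ennreal r * Y \<le> \<psi> s}"
      using order_trans[OF div[of "\<phi>0 _" x] le(1)] order_trans[OF div[of "\<psi>0 _" y] le(2)] x y by auto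
    fix s t assume st: "s \<in> {s. ennreal r * X \<le> \<phi> s}" "t \<in> {s. ennreal r * Y \<le> \<psi> s}"
    have "ennreal r * ennreal c = ennreal_pow (ennreal r * X) (1 - l) * ennreal_pow (ennreal r * Y) l"
    proof -
      have "r * c = (r * x) powr (1 - l) * (r * y) powr l"
        using r x y by (simp add: c_def powr_mult powr_diff)
      then show ?thesis
        using r x y c by (simp add: ennreal_pow_ennreal flip: ennreal_mult)
    qed
    also have "\<dots> \<le> ennreal_pow (\<phi> s) (1 - l) * ennreal_pow (\<psi> t) l"
      using st l by (intro mult_mono ennreal_pow_mono) auto
    also have "\<dots> \<le> m ((1 - l) * s + l * t)"
      by (rule m)
    finally have "ennreal r * ennreal c / ennreal c \<le> m ((1 - l) * s + l * t) / ennreal c"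
      by (rule divide_right_mono_ennreal)
    then show "(1 - l) * s + l * t \<in> {s. ennreal r \<le> m s / ennreal c}"
      using c by (simp add: ennreal_mult_divide_eq)
  qed measurable
  \<comment> \<open>The cutoff at 1 costs nothing for the normalized minorants, which are at most 1,
    and only decreases the integral of m / c.\<close>
  have "ennreal (1 - l) * ((\<integral>\<^sup>+s. \<phi>0 s \<partial>lborel) / X) + ennreal l * ((\<integral>\<^sup>+s. \<psi>0 s \<partial>lborel) / Y) =
      ennreal (1 - l) * (\<integral>\<^sup>+s. min 1 (\<phi>0 s / X) \<partial>lborel) + ennreal l * (\<integral>\<^sup>+s. min 1 (\<psi>0 s / Y) \<partial>lborel)"
    using le_1 by (simp add: nn_integral_divide min_absorb2)
  also have "\<dots> = (\<integral>\<^sup>+r. ennreal (1 - l) * (indicator {0<..<1} r * emeasure lborel {s. ennreal r \<le> \<phi>0 s / X}) +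
      ennreal l * (indicator {0<..<1} r * emeasure lborel {s. ennreal r \<le> \<psi>0 s / Y}) \<partial>lborel)"
    by (simp add: nn_integral_min_1_eq nn_integral_add nn_integral_cmult)
  also have "\<dots> \<le> (\<integral>\<^sup>+r. indicator {0<..<1} r * emeasure lborel {s. ennreal r \<le> m s / ennreal c} \<partial>lborel)"
    by (intro nn_integral_mono) (auto simp: indicator_def levels)
  also have "\<dots> = (\<integral>\<^sup>+s. min 1 (m s / ennreal c) \<partial>lborel)"
    by (simp add: nn_integral_min_1_eq)
  also have "\<dots> \<le> (\<integral>\<^sup>+s. m s / ennreal c \<partial>lborel)"
    by (intro nn_integral_mono) simp
  also have "\<dots> = (\<integral>\<^sup>+s. m s \<partial>lborel) / ennreal c"
    by (simp add: nn_integral_divide)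
  finally have "ennreal c * (ennreal (1 - l) * ((\<integral>\<^sup>+s. \<phi>0 s \<partial>lborel) / X) + ennreal l * ((\<integral>\<^sup>+s. \<psi>0 s \<partial>lborel) / Y))
    \<le> ennreal c * ((\<integral>\<^sup>+s. m s \<partial>lborel) / ennreal c)"
    by (rule mult_left_mono) simp
  also have "\<dots> = (\<integral>\<^sup>+s. m s \<partial>lborel)"
    using c by (simp add: ennreal_times_divide mult.commute[of "ennreal c"] ennreal_mult_divide_eq)
  finally show ?thesis
    by (simp add: c_eq)
qed

section \<open>Non-measurable projections\<close>

text \<open>The pointwise infimum of a minimizing sequence of measurable majorants is again
  one.\<close>

lemma upper_integral_attained:
  fixes F :: "'a \<Rightarrow> ennreal"
  obtains Fs where "Fs \<in> borel_measurable N" "\<And>x. x \<in> space N \<Longrightarrow> F x \<le> Fs x"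
    "(\<integral>\<^sup>+x. Fs x \<partial>N) = upper_integral N F"
proof -
  define K where "K = {k \<in> borel_measurable N. \<forall>x\<in>space N. F x \<le> k x}"
  have "(\<lambda>_. top) \<in> K"
    by (simp add: K_def)
  then have "(\<lambda>k. integral\<^sup>N N k) ` K \<noteq> {}" by blast
  then obtain v :: "nat \<Rightarrow> ennreal" where v: "range v \<subseteq> (\<lambda>k. integral\<^sup>N N k) ` K"
      "Inf ((\<lambda>k. integral\<^sup>N N k) ` K) = (INF n. v n)"
    using ennreal_Inf_countable_INF by metis
  have "\<exists>k\<in>K. v n = integral\<^sup>N N k" for n
    using v(1) by blast
  then obtain k where k: "\<And>n. k n \<in> K" "\<And>n. v n = integral\<^sup>N N (k n)"
    by metis
  define Fs where "Fs x = (INF n. k n x)" for x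
  have upper: "upper_integral N F = (INF n. v n)"
    by (simp add: upper_integral_def K_def[symmetric] v(2))
  have "Fs \<in> borel_measurable N"
    unfolding Fs_def using k(1) by (intro borel_measurable_INF) (auto simp: K_def)
  then have Fs: "Fs \<in> K"
    using k(1) by (auto simp: K_def Fs_def intro!: INF_greatest)
  have "integral\<^sup>N N Fs \<le> upper_integral N F"
    unfolding upper k(2) by (intro INF_greatest nn_integral_mono) (auto simp: Fs_def intro: INF_lower)
  moreover have "upper_integral N F \<le> integral\<^sup>N N Fs"
    unfolding upper_integral_def K_def[symmetric] using Fs by (rule INF_lower)
  ultimately show ?thesis
    using that[of Fs] Fs by (auto simp: K_def)
qed

text \<open>Otherwise lowering \<open>Fs\<close> to \<theta> times \<open>Fs\<close> on E would
  yield a measurable majorant of F with strictly smaller integral; finiteness of the upper integral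
  makes the comparison strict.\<close>

lemma upper_integral_sharp:
  fixes F Fs :: "'a \<Rightarrow> ennreal"
  assumes [measurable]: "Fs \<in> borel_measurable N" "E \<in> sets N"
    and le: "\<And>x. x \<in> space N \<Longrightarrow> F x \<le> Fs x"
    and eq: "(\<integral>\<^sup>+x. Fs x \<partial>N) = upper_integral N F" and fin: "upper_integral N F < \<infinity>"
    and \<theta>: "0 \<le> \<theta>" "\<theta> < 1" and E: "\<And>x. x \<in> E \<Longrightarrow> F x \<le> ennreal \<theta> * Fs x"
  shows "AE x in N. x \<in> E \<longrightarrow> Fs x = 0"
proof -
  define k where "k x = ennreal \<theta> * (Fs x * indicator E x) + Fs x * indicator (space N - E) x" for x
  have [measurable]: "k \<in> borel_measurable N"
    unfolding k_def by measurable
  have split: "(\<integral>\<^sup>+x. Fs x \<partial>N) = (\<integral>\<^sup>+x. Fs x * indicator E x \<partial>N) + (\<integral>\<^sup>+x. Fs x * indicator (space N - E) x \<partial>N)"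
    by (subst nn_integral_add[symmetric]) (auto intro!: nn_integral_cong simp: indicator_def)
  have int_k: "(\<integral>\<^sup>+x. k x \<partial>N) = ennreal \<theta> * (\<integral>\<^sup>+x. Fs x * indicator E x \<partial>N) + (\<integral>\<^sup>+x. Fs x * indicator (space N - E) x \<partial>N)"
    unfolding k_def by (simp add: nn_integral_add nn_integral_cmult)
  have "upper_integral N F \<le> (\<integral>\<^sup>+x. k x \<partial>N)"
    unfolding upper_integral_def
  proof (rule INF_lower)
    have "F x \<le> k x" if "x \<in> space N" for x
      using le[OF that] E[of x] that by (cases "x \<in> E") (auto simp: k_def)
    then show "k \<in> {k \<in> borel_measurable N. \<forall>x\<in>space N. F x \<le> k x}" by simp
  qed
  then have "(\<integral>\<^sup>+x. Fs x * indicator E x \<partial>N) + (\<integral>\<^sup>+x. Fs x * indicator (space N - E) x \<partial>N) \<le>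
      ennreal \<theta> * (\<integral>\<^sup>+x. Fs x * indicator E x \<partial>N) + (\<integral>\<^sup>+x. Fs x * indicator (space N - E) x \<partial>N)"
    using eq split int_k by simp
  moreover have "(\<integral>\<^sup>+x. Fs x * indicator (space N - E) x \<partial>N) < \<infinity>" "(\<integral>\<^sup>+x. Fs x * indicator E x \<partial>N) < \<infinity>"
    using fin unfolding eq[symmetric] split by (auto simp: less_top)
  ultimately have "(\<integral>\<^sup>+x. Fs x * indicator E x \<partial>N) \<le> ennreal \<theta> * (\<integral>\<^sup>+x. Fs x * indicator E x \<partial>N)"
    by (auto simp: add.commute[of _ "\<integral>\<^sup>+x. Fs x * indicator (space N - E) x \<partial>N"] ennreal_add_left_cancel_le)
  with \<open>(\<integral>\<^sup>+x. Fs x * indicator E x \<partial>N) < \<infinity>\<close> have "(\<integral>\<^sup>+x. Fs x * indicator E x \<partial>N) = 0"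
  proof (cases "\<integral>\<^sup>+x. Fs x * indicator E x \<partial>N")
    case (real r)
    with \<open>(\<integral>\<^sup>+x. Fs x * indicator E x \<partial>N) \<le> _\<close> have "r \<le> \<theta> * r"
      using \<theta> by (simp add: ennreal_mult[symmetric] ennreal_le_iff)
    with \<theta> real have "r = 0"
      using mult_left_less_imp_less[of r 1 \<theta>] mult_less_cancel_right2[of \<theta> r] by (cases "r = 0") auto
    with real show ?thesis by simp
  qed simp
  then have "AE x in N. Fs x * indicator E x = 0"
    by (subst (asm) nn_integral_0_iff_AE) auto
  then show ?thesis
    by eventually_elim auto
qed

lemma ennreal_divide_left_mono:
  fixes a b x :: ennreal
  assumes "a \<le> b"
  shows "x / b \<le> x / a"
proof -
  have "inverse b \<le> inverse a"
  proof (cases "a = 0 \<or> b = top")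
    case False
    then obtain r s where "a = ennreal r" "b = ennreal s" "0 \<le> r" "r \<noteq> 0" "0 \<le> s"
      using assms by (cases a; cases b) (auto simp: top_unique)
    with assms show ?thesis
      by (auto simp: ennreal_le_iff inverse_ennreal intro!: ennreal_leI le_imp_inverse_le)
  qed auto
  then show ?thesis
    unfolding divide_ennreal_def by (rule mult_left_mono) simp
qed

text \<open>Where F > \<theta> Fs and G > \<theta> Gs, replacing F and G by their majorants costs
  the factor \<theta> = \<theta>^(1-l) \<theta>^l in the powers, and larger denominators only lower
  the left side. Measurability of the bad pairs and \<open>upper_integral_sharp\<close>, applied
  first in y and then in x, extend this to almost every pair; finally \<theta> tends to 1.\<close>

lemma PiM_inequality_upper:
  fixes F G P Q M :: "('i \<Rightarrow> real) \<Rightarrow> ennreal" and l :: real and I :: "'i set"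
  defines "N \<equiv> PiM I (\<lambda>_. lborel :: real measure)"
  defines "A \<equiv> upper_integral N F" and "B \<equiv> upper_integral N G"
  assumes l: "0 < l" "l < 1" and I: "finite I"
    and P_meas: "P \<in> borel_measurable N" and Q_meas: "Q \<in> borel_measurable N"
    and M_meas: "M \<in> borel_measurable N"
    and A: "0 < A" "A < \<infinity>" and B: "0 < B" "B < \<infinity>"
    and P0: "\<And>x. F x = 0 \<Longrightarrow> P x = 0" and Q0: "\<And>x. G x = 0 \<Longrightarrow> Q x = 0"
    and le: "\<And>x y. 0 < F x \<Longrightarrow> F x < \<infinity> \<Longrightarrow> 0 < G y \<Longrightarrow> G y < \<infinity> \<Longrightarrow>
      ennreal_pow (F x) (1 - l) * ennreal_pow (G y) l *
        (ennreal (1 - l) * (P x / F x) + ennreal l * (Q y / G y)) \<le> M (combination I l x y)"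
  shows "ennreal_pow A (1 - l) * ennreal_pow B l *
      (ennreal (1 - l) * ((\<integral>\<^sup>+x. P x \<partial>N) / A) + ennreal l * ((\<integral>\<^sup>+x. Q x \<partial>N) / B)) \<le> (\<integral>\<^sup>+x. M x \<partial>N)"
proof -
  note [measurable] = P_meas Q_meas M_meas
  interpret N: sigma_finite_measure N
    unfolding N_def using I by (rule sigma_finite_PiM_lborel)
  interpret NN: pair_sigma_finite N N ..
  obtain Fs where Fs [measurable]: "Fs \<in> borel_measurable N" and F_le: "\<And>x. x \<in> space N \<Longrightarrow> F x \<le> Fs x"
    and Fs_int: "(\<integral>\<^sup>+x. Fs x \<partial>N) = A"
    unfolding A_def by (rule upper_integral_attained[of N F]) blast
  obtain Gs where Gs [measurable]: "Gs \<in> borel_measurable N" and G_le: "\<And>x. x \<in> space N \<Longrightarrow> G x \<le> Gs x"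
    and Gs_int: "(\<integral>\<^sup>+x. Gs x \<partial>N) = B"
    unfolding B_def by (rule upper_integral_attained[of N G]) blast
  have Fs_fin: "AE x in N. Fs x < \<infinity>"
    using nn_integral_PInf_AE[of Fs N] A Fs_int by (auto simp: less_top)
  have Gs_fin: "AE x in N. Gs x < \<infinity>"
    using nn_integral_PInf_AE[of Gs N] B Gs_int by (auto simp: less_top)
  have comb [measurable]: "(\<lambda>z. combination I l (fst z) (snd z)) \<in> N \<Otimes>\<^sub>M N \<rightarrow>\<^sub>M N"
    unfolding N_def by (intro measurable_combination) measurable
  define \<Psi> where "\<Psi> x y = ennreal_pow (Fs x) (1 - l) * ennreal_pow (Gs y) l *
    (ennreal (1 - l) * (P x / Fs x) + ennreal l * (Q y / Gs y))" for x y
  have quot: "(\<integral>\<^sup>+x. f x * (h x / f x) \<partial>N) = (\<integral>\<^sup>+x. h x \<partial>N)"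
    if "AE x in N. f x < \<infinity>" "\<And>x. x \<in> space N \<Longrightarrow> f x = 0 \<Longrightarrow> h x = 0" for f h :: "('i \<Rightarrow> real) \<Rightarrow> ennreal"
  proof (rule nn_integral_cong_AE)
    show "AE x in N. f x * (h x / f x) = h x"
      using that(1) AE_space
    proof eventually_elim
      case (elim x)
      then show ?case
        using that(2)[of x] by (cases "f x = 0") (auto simp: ennreal_times_divide mult.commute[of "f x"] ennreal_mult_divide_eq)
    qed
  qed
  have int_P: "(\<integral>\<^sup>+x. Fs x * (P x / Fs x) \<partial>N) = (\<integral>\<^sup>+x. P x \<partial>N)"
  proof (rule quot[OF Fs_fin])
    show "P x = 0" if "x \<in> space N" "Fs x = 0" for x
      using F_le[OF that(1)] that(2) P0[of x] by simp
  qed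
  have int_Q: "(\<integral>\<^sup>+x. Gs x * (Q x / Gs x) \<partial>N) = (\<integral>\<^sup>+x. Q x \<partial>N)"
  proof (rule quot[OF Gs_fin])
    show "Q x = 0" if "x \<in> space N" "Gs x = 0" for x
      using G_le[OF that(1)] that(2) Q0[of x] by simp
  qed
  have bound: "ennreal \<theta> * (ennreal_pow A (1 - l) * ennreal_pow B l *
      (ennreal (1 - l) * ((\<integral>\<^sup>+x. P x \<partial>N) / A) + ennreal l * ((\<integral>\<^sup>+x. Q x \<partial>N) / B))) \<le> (\<integral>\<^sup>+x. M x \<partial>N)"
    if \<theta>: "0 < \<theta>" "\<theta> < 1" for \<theta> :: real
  proof -
    have point: "ennreal \<theta> * \<Psi> x y \<le> M (combination I l x y)"
      if x: "x \<in> space N" "ennreal \<theta> * Fs x < F x" "Fs x < \<infinity>"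
        and y: "y \<in> space N" "ennreal \<theta> * Gs y < G y" "Gs y < \<infinity>" for x y
    proof -
      have FG: "0 < F x" "F x < \<infinity>" "0 < G y" "G y < \<infinity>"
        using x y F_le[OF x(1)] G_le[OF y(1)] by (auto simp: zero_less_iff_neq_zero)
      have "ennreal \<theta> * \<Psi> x y = (ennreal (\<theta> powr (1 - l)) * ennreal_pow (Fs x) (1 - l)) *
          (ennreal (\<theta> powr l) * ennreal_pow (Gs y) l) *
          (ennreal (1 - l) * (P x / Fs x) + ennreal l * (Q y / Gs y))"
      proof -
        have "\<theta> = \<theta> powr (1 - l) * \<theta> powr l"
          using \<theta> by (simp add: powr_add[symmetric])
        then have "ennreal \<theta> = ennreal (\<theta> powr (1 - l)) * ennreal (\<theta> powr l)"
          by (metis ennreal_mult powr_ge_zero)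
        then show ?thesis
          unfolding \<Psi>_def by (simp only: ac_simps)
      qed
      also have "\<dots> = ennreal_pow (ennreal \<theta> * Fs x) (1 - l) * ennreal_pow (ennreal \<theta> * Gs y) l *
          (ennreal (1 - l) * (P x / Fs x) + ennreal l * (Q y / Gs y))"
        using \<theta> x y by (simp add: ennreal_pow_mult)
      also have "\<dots> \<le> ennreal_pow (F x) (1 - l) * ennreal_pow (G y) l *
          (ennreal (1 - l) * (P x / F x) + ennreal l * (Q y / G y))"
        using l x y F_le[OF x(1)] G_le[OF y(1)]
        by (intro mult_mono add_mono ennreal_pow_mono ennreal_divide_left_mono order_refl) auto
      also have "\<dots> \<le> M (combination I l x y)"
        using FG by (rule le)
      finally show ?thesis .
    qed
    define bad where "bad x y \<longleftrightarrow> \<not> ennreal \<theta> * \<Psi> x y \<le> M (combination I l x y)" for x y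
    have bad_pred [measurable]: "Measurable.pred (N \<Otimes>\<^sub>M N) (\<lambda>z. bad (fst z) (snd z))"
      unfolding bad_def \<Psi>_def by measurable
    have bad_y: "{y \<in> space N. bad x y \<and> Gs y < \<infinity>} \<in> sets N" if "x \<in> space N" for x
    proof -
      have "(\<lambda>y. (x, y)) \<in> N \<rightarrow>\<^sub>M N \<Otimes>\<^sub>M N" using that by measurable
      from measurable_compose[OF this bad_pred] have "Measurable.pred N (bad x)" by simp
      then show ?thesis by measurable
    qed
    \<comment> \<open>A vanishing majorant makes the left side 0. Hence the conclusion of
      \<open>upper_integral_sharp\<close>, that the majorant vanishes on the bad set, excludes bad
      pairs.\<close>
    have bad_pos: "Fs x \<noteq> 0" "Gs y \<noteq> 0" if "bad x y" for x y
      using that by (auto simp: bad_def \<Psi>_def)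
    have AE_y: "AE y in N. \<not> bad x y" if x: "x \<in> space N" "ennreal \<theta> * Fs x < F x" "Fs x < \<infinity>" for x
    proof -
      have "AE y in N. y \<in> {y \<in> space N. bad x y \<and> Gs y < \<infinity>} \<longrightarrow> Gs y = 0"
      proof (rule upper_integral_sharp[where F=G and \<theta>=\<theta>])
        show "G y \<le> ennreal \<theta> * Gs y" if "y \<in> {y \<in> space N. bad x y \<and> Gs y < \<infinity>}" for y
          using point[OF x, of y] that by (auto simp: bad_def not_less[symmetric])
      qed (use bad_y[OF x(1)] G_le Gs_int B \<theta> Gs in \<open>auto simp: B_def\<close>)
      then show ?thesis
        using Gs_fin AE_space by eventually_elim (use bad_pos(2) in auto)
    qed
    \<comment> \<open>The points with a non-null bad section. Measuring the section by an integral
      makes \<open>D\<close> measurable by Fubini, and by \<open>AE_y\<close> none of its points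
      satisfies F > \<theta> Fs.\<close>
    define D where "D = {x \<in> space N. (\<integral>\<^sup>+y. indicator {z. bad (fst z) (snd z)} (x, y) \<partial>N) \<noteq> 0 \<and> Fs x < \<infinity>}"
    have ind [measurable]: "(\<lambda>z. indicator {z. bad (fst z) (snd z)} z :: ennreal) \<in> borel_measurable (N \<Otimes>\<^sub>M N)"
      by measurable
    have D [measurable]: "D \<in> sets N"
      unfolding D_def by measurable
    have D_iff: "(\<integral>\<^sup>+y. indicator {z. bad (fst z) (snd z)} (x, y) \<partial>N) = 0 \<longleftrightarrow> (AE y in N. \<not> bad x y)"
      if "x \<in> space N" for x
    proof (subst nn_integral_0_iff_AE)
      have "(\<lambda>y. (x, y)) \<in> N \<rightarrow>\<^sub>M N \<Otimes>\<^sub>M N" using that by measurable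
      from measurable_compose[OF this ind]
      show "(\<lambda>y. indicator {z. bad (fst z) (snd z)} (x, y) :: ennreal) \<in> borel_measurable N" .
    qed (simp add: indicator_def)
    have "AE x in N. x \<in> D \<longrightarrow> Fs x = 0"
    proof (rule upper_integral_sharp[where F=F and \<theta>=\<theta>])
      show "F x \<le> ennreal \<theta> * Fs x" if "x \<in> D" for x
        using AE_y[of x] D_iff[of x] that by (auto simp: D_def not_less[symmetric])
    qed (use F_le Fs_int A \<theta> Fs in \<open>auto simp: A_def\<close>)
    then have "AE x in N. AE y in N. \<not> bad x y"
      using Fs_fin AE_space
    proof eventually_elim
      case (elim x)
      show ?case
      proof (cases "x \<in> D")
        case True
        then have "\<not> bad x y" for y using elim bad_pos(1)[of x y] by auto
        then show ?thesis by simp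
      next
        case False
        then show ?thesis using elim D_iff[of x] by (auto simp: D_def)
      qed
    qed
    then have "AE z in N \<Otimes>\<^sub>M N. \<not> bad (fst z) (snd z)"
      by (intro NN.AE_pair_measure) simp_all
    \<comment> \<open>The factor \<theta> is charged to p and q, so that the masses of the majorants
      remain A and B.\<close>
    then have "AE z in N \<Otimes>\<^sub>M N. ennreal_pow (Fs (fst z)) (1 - l) * ennreal_pow (Gs (snd z)) l *
        (ennreal (1 - l) * (ennreal \<theta> * (P (fst z) / Fs (fst z))) + ennreal l * (ennreal \<theta> * (Q (snd z) / Gs (snd z))))
        \<le> M (combination I l (fst z) (snd z))"
      by eventually_elim (simp add: bad_def \<Psi>_def distrib_left ac_simps)
    then have "ennreal_pow A (1 - l) * ennreal_pow B l *
      (ennreal (1 - l) * ((\<integral>\<^sup>+x. Fs x * (ennreal \<theta> * (P x / Fs x)) \<partial>N) / A) +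
       ennreal l * ((\<integral>\<^sup>+x. Gs x * (ennreal \<theta> * (Q x / Gs x)) \<partial>N) / B)) \<le> (\<integral>\<^sup>+x. M x \<partial>N)"
      using PiM_inequality[OF l I, of Fs Gs "\<lambda>x. ennreal \<theta> * (P x / Fs x)" "\<lambda>x. ennreal \<theta> * (Q x / Gs x)" M,
        folded N_def, unfolded Fs_int Gs_int] A B by simp
    moreover have "(\<integral>\<^sup>+x. Fs x * (ennreal \<theta> * (P x / Fs x)) \<partial>N) = ennreal \<theta> * (\<integral>\<^sup>+x. P x \<partial>N)"
      by (simp add: int_P[symmetric] nn_integral_cmult[symmetric] ac_simps)
    moreover have "(\<integral>\<^sup>+x. Gs x * (ennreal \<theta> * (Q x / Gs x)) \<partial>N) = ennreal \<theta> * (\<integral>\<^sup>+x. Q x \<partial>N)"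
      by (simp add: int_Q[symmetric] nn_integral_cmult[symmetric] ac_simps)
    ultimately show ?thesis
      by (simp add: distrib_left ennreal_times_divide[symmetric] ac_simps)
  qed
  define R where "R = ennreal_pow A (1 - l) * ennreal_pow B l *
      (ennreal (1 - l) * ((\<integral>\<^sup>+x. P x \<partial>N) / A) + ennreal l * ((\<integral>\<^sup>+x. Q x \<partial>N) / B))"
  \<comment> \<open>Denominators start at 2 so that \<theta> is positive. An infinite R is treated
    apart, the sequence then being constant.\<close>
  have "(\<lambda>n. ennreal (1 - 1 / real (Suc (Suc n))) * R) \<longlonglongrightarrow> ennreal (1 - 0) * R"
  proof (cases "R = \<infinity>")
    case True
    have "0 < 1 - 1 / real (Suc (Suc n))" for n
      by (simp add: field_simps)
    then have "(\<lambda>n. ennreal (1 - 1 / real (Suc (Suc n))) * R) = (\<lambda>n. R)"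
      using True by (intro ext) (simp add: ennreal_mult_top del: of_nat_Suc)
    then show ?thesis
      by (simp only: diff_zero ennreal_1 mult_1 tendsto_const)
  next
    case False
    have "(\<lambda>n. 1 / real (Suc (Suc n))) \<longlonglongrightarrow> 0"
      by (rule LIMSEQ_Suc[OF LIMSEQ_Suc[OF lim_1_over_n]])
    from tendsto_diff[OF tendsto_const this, of 1]
    have "(\<lambda>n. 1 - 1 / real (Suc (Suc n))) \<longlonglongrightarrow> 1 - 0" .
    then show ?thesis
      using False by (intro tendsto_mult_ennreal tendsto_ennrealI tendsto_const) (auto simp: less_top)
  qed
  then show ?thesis
    unfolding R_def[symmetric] using bound[folded R_def]
    by (intro LIMSEQ_le_const2[of _ R]) (auto simp: field_simps)
qed

section \<open>Orthonormal coordinates\<close>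

definition orthonormal_set :: "'a::real_inner set \<Rightarrow> bool" where
  "orthonormal_set B \<longleftrightarrow> pairwise orthogonal B \<and> (\<forall>b\<in>B. norm b = 1)"

lemma orthonormal_set_inner:
  "orthonormal_set B \<Longrightarrow> a \<in> B \<Longrightarrow> b \<in> B \<Longrightarrow> inner a b = (if a = b then 1 else 0)"
  by (auto simp: orthonormal_set_def pairwise_def orthogonal_def norm_eq_1)

lemma orthonormal_set_independent:
  assumes "orthonormal_set B"
  shows "independent B"
  using assms by (intro pairwise_orthogonal_independent) (auto simp: orthonormal_set_def)

lemma orthonormal_set_finite:
  fixes B :: "'a::euclidean_space set"
  shows "orthonormal_set B \<Longrightarrow> finite B"
  using orthonormal_set_independent independent_imp_finite by blast

lemma inner_sum_orthonormal:
  fixes B :: "'a::euclidean_space set"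
  assumes B: "orthonormal_set B" and b: "b \<in> B"
  shows "inner (\<Sum>a\<in>B. c a *\<^sub>R a) b = c b"
proof -
  have "inner (\<Sum>a\<in>B. c a *\<^sub>R a) b = (\<Sum>a\<in>B. if a = b then c b else 0)"
    unfolding inner_sum_left by (intro sum.cong) (auto simp: orthonormal_set_inner[OF B _ b])
  then show ?thesis
    using b orthonormal_set_finite[OF B] by simp
qed

lemma orthonormal_expansion:
  fixes B :: "'a::euclidean_space set"
  assumes B: "orthonormal_set B" and x: "x \<in> span B"
  shows "(\<Sum>b\<in>B. inner x b *\<^sub>R b) = x"
proof -
  obtain c where c: "x = (\<Sum>b\<in>B. c b *\<^sub>R b)"
    using x orthonormal_set_finite[OF B] by (auto simp: span_finite)
  then have "inner x b = c b" if "b \<in> B" for b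
    using inner_sum_orthonormal[OF B that, of c] by simp
  then show ?thesis using c by (simp cong: sum.cong)
qed

section \<open>Invariance of Lebesgue measure under translations and orthogonal maps\<close>

lemma nn_integral_lborel_translation:
  fixes f :: "'a::euclidean_space \<Rightarrow> ennreal"
  assumes [measurable]: "f \<in> borel_measurable borel"
  shows "(\<integral>\<^sup>+x. f (x + c) \<partial>lborel) = (\<integral>\<^sup>+x. f x \<partial>lborel)"
proof -
  have "(\<integral>\<^sup>+x. f x \<partial>distr lborel borel ((+) c)) = (\<integral>\<^sup>+x. f (c + x) \<partial>lborel)"
    by (rule nn_integral_distr) simp_all
  then show ?thesis
    by (simp add: lborel_distr_plus add.commute)
qed

text \<open>
  This is the uniqueness of Haar measure: transform the double integral of \<open>1\<^sub>A(T z) 1\<^sub>B(y)\<close> by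
  \<open>y \<mapsto> y + T z\<close> and then, with \<open>T w = y\<close>, by \<open>z \<mapsto> z - w\<close>.
\<close>

lemma lborel_vimage_proportional:
  fixes T :: "'a::euclidean_space \<Rightarrow> 'a"
  assumes T [measurable]: "T \<in> borel_measurable borel"
    and add: "\<And>z w. T (z + w) = T z + T w" and surj: "surj T"
    and A [measurable]: "A \<in> sets borel" and B [measurable]: "B \<in> sets borel"
  shows "emeasure lborel B * emeasure lborel (T -` A) = emeasure lborel (T -` B) * emeasure lborel (uminus -` A)"
proof -
  let ?i = "indicator :: 'a set \<Rightarrow> 'a \<Rightarrow> ennreal"
  have vimage: "emeasure lborel (f -` S) = (\<integral>\<^sup>+z. ?i S (f z) \<partial>lborel)"
    if "f \<in> borel_measurable borel" "S \<in> sets borel" for f :: "'a \<Rightarrow> 'a" and S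
  proof -
    have "?i S (f z) = ?i (f -` S) z" for z
      by (simp add: indicator_def)
    then show ?thesis
      using measurable_sets_borel[OF that] by simp
  qed
  have fst_snd: "(\<lambda>z. fst z :: 'a) \<in> borel_measurable (lborel \<Otimes>\<^sub>M lborel :: ('a \<times> 'a) measure)"
    "(\<lambda>z. snd z :: 'a) \<in> borel_measurable (lborel \<Otimes>\<^sub>M lborel :: ('a \<times> 'a) measure)"
    using measurable_fst[of "lborel :: 'a measure" "lborel :: 'a measure"]
      measurable_snd[of "lborel :: 'a measure" "lborel :: 'a measure"] by simp_all
  have ind: "(\<lambda>z. ?i A (f z) * ?i B (g z)) \<in> borel_measurable (lborel \<Otimes>\<^sub>M lborel :: ('a \<times> 'a) measure)"
    if "f \<in> borel_measurable (lborel \<Otimes>\<^sub>M lborel)" "g \<in> borel_measurable (lborel \<Otimes>\<^sub>M lborel)" for f g :: "'a \<times> 'a \<Rightarrow> 'a"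
    using that by (intro borel_measurable_times_ennreal measurable_compose[OF _ borel_measurable_indicator]) auto
  have T_snd: "(\<lambda>z. T (snd z)) \<in> borel_measurable (lborel \<Otimes>\<^sub>M lborel :: ('a \<times> 'a) measure)"
    by (rule measurable_compose[OF fst_snd(2) T])
  have iT: "(\<lambda>z. ?i S (T z)) \<in> borel_measurable lborel" if "S \<in> sets borel" for S
    using measurable_compose[OF T borel_measurable_indicator[OF that]] by simp
  have "emeasure lborel B * emeasure lborel (T -` A) = (\<integral>\<^sup>+z. ?i A (T z) * (\<integral>\<^sup>+y. ?i B y \<partial>lborel) \<partial>lborel)"
    by (simp add: vimage[OF T A] nn_integral_multc[OF iT[OF A]] mult.commute[of "emeasure lborel B"])
  also have "\<dots> = (\<integral>\<^sup>+z. \<integral>\<^sup>+y. ?i A (T z) * ?i B (y + T z) \<partial>lborel \<partial>lborel)"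
  proof (rule nn_integral_cong)
    fix z
    show "?i A (T z) * (\<integral>\<^sup>+y. ?i B y \<partial>lborel) = (\<integral>\<^sup>+y. ?i A (T z) * ?i B (y + T z) \<partial>lborel)"
      by (subst nn_integral_lborel_translation[of "?i B" "T z", symmetric]) (simp_all add: nn_integral_cmult)
  qed
  also have "\<dots> = (\<integral>\<^sup>+y. \<integral>\<^sup>+z. ?i A (T z) * ?i B (y + T z) \<partial>lborel \<partial>lborel)"
    using lborel_pair.Fubini'[of "\<lambda>y z. ?i A (T z) * ?i B (y + T z)"]
      ind[OF T_snd borel_measurable_add[OF fst_snd(1) T_snd]] by (simp add: case_prod_beta)
  also have "\<dots> = (\<integral>\<^sup>+y. \<integral>\<^sup>+z. ?i A (T z - y) * ?i B (T z) \<partial>lborel \<partial>lborel)"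
  proof (rule nn_integral_cong)
    fix y
    obtain w where w: "y = T w" using surj by (metis surjD)
    have "T (z + w) - y = T z" "T (z + w) = y + T z" for z
      by (simp_all add: add w)
    then show "(\<integral>\<^sup>+z. ?i A (T z) * ?i B (y + T z) \<partial>lborel) = (\<integral>\<^sup>+z. ?i A (T z - y) * ?i B (T z) \<partial>lborel)"
      using nn_integral_lborel_translation[of "\<lambda>z. ?i A (T z - y) * ?i B (T z)" w] by simp
  qed
  also have "\<dots> = (\<integral>\<^sup>+z. \<integral>\<^sup>+y. ?i A (T z - y) * ?i B (T z) \<partial>lborel \<partial>lborel)"
    using lborel_pair.Fubini'[of "\<lambda>y z. ?i A (T z - y) * ?i B (T z)"]
      ind[OF borel_measurable_diff[OF T_snd fst_snd(1)] T_snd] by (simp add: case_prod_beta)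
  also have "\<dots> = (\<integral>\<^sup>+z. emeasure lborel (uminus -` A) * ?i B (T z) \<partial>lborel)"
  proof (rule nn_integral_cong)
    fix z
    have "(\<integral>\<^sup>+y. ?i A (T z - y) \<partial>lborel) = (\<integral>\<^sup>+y. ?i A (- y) \<partial>lborel)"
      using nn_integral_lborel_translation[of "\<lambda>y. ?i A (T z - y)" "T z"] by simp
    then show "(\<integral>\<^sup>+y. ?i A (T z - y) * ?i B (T z) \<partial>lborel) = emeasure lborel (uminus -` A) * ?i B (T z)"
      by (simp add: nn_integral_multc vimage)
  qed
  also have "\<dots> = emeasure lborel (T -` B) * emeasure lborel (uminus -` A)"
    unfolding nn_integral_cmult[OF iT[OF B]] vimage[OF T B] by (rule mult.commute)
  finally show ?thesis .
qed

text \<open>The constant of proportionality is found on the unit ball, which T preserves and whose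
  measure is positive and finite. The reflection occurring in
  \<open>lborel_vimage_proportional\<close> is removed by applying that lemma to the identity as
  well.\<close>

lemma lborel_distr_orthogonal_transformation:
  fixes T :: "'a::euclidean_space \<Rightarrow> 'a"
  assumes T: "orthogonal_transformation T"
  shows "distr lborel borel T = lborel"
proof (rule measure_eqI)
  have T_meas: "T \<in> borel_measurable borel"
    using orthogonal_transformation_linear[OF T]
    by (intro borel_measurable_continuous_onI linear_continuous_on) (simp add: linear_conv_bounded_linear)
  let ?B = "ball 0 1 :: 'a set"
  fix A assume "A \<in> sets (distr lborel borel T)"
  then have A: "A \<in> sets borel" by simp
  have "T -` ?B = ?B"
    by (auto simp: orthogonal_transformation_norm[OF T])
  then have "emeasure lborel ?B * emeasure lborel (T -` A) = emeasure lborel ?B * emeasure lborel (uminus -` A)"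
    using lborel_vimage_proportional[OF T_meas linear_add[OF orthogonal_transformation_linear[OF T]]
        orthogonal_transformation_surj[OF T] A, of ?B] by simp
  also have "\<dots> = emeasure lborel ?B * emeasure lborel A"
    using lborel_vimage_proportional[of "\<lambda>z::'a. z" A ?B] A by simp
  finally have "emeasure lborel (T -` A) = emeasure lborel A"
    using emeasure_lborel_ball_finite[of "0::'a" 1] content_ball_pos[of 1 "0::'a"]
    by (subst (asm) ennreal_mult_cancel_left) (auto simp: measure_def less_top)
  then show "emeasure (distr lborel borel T) A = emeasure lborel A"
    using T_meas A by (simp add: emeasure_distr)
qed simp

lemma orthonormal_basis_transformation:
  fixes B :: "'a::euclidean_space set"
  assumes B: "orthonormal_set B" "span B = UNIV"
  obtains T :: "'a \<Rightarrow> 'a" and \<pi> where "orthogonal_transformation T" "bij_betw \<pi> Basis B"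
    "\<And>x a. a \<in> Basis \<Longrightarrow> inner (T x) (\<pi> a) = inner x a"
proof -
  have "card B = DIM('a)"
    using basis_card_eq_dim[of B UNIV] orthonormal_set_independent[OF B(1)] B(2) by simp
  then obtain \<pi> where \<pi>: "bij_betw \<pi> (Basis :: 'a set) B"
    using orthonormal_set_finite[OF B(1)] finite_same_card_bij[of "Basis :: 'a set" B] by auto
  define T where "T x = (\<Sum>a\<in>Basis. inner x a *\<^sub>R \<pi> a)" for x :: 'a
  have \<pi>B: "\<pi> a \<in> B" if "a \<in> Basis" for a
    using \<pi> that by (auto simp: bij_betw_def)
  have \<pi>_inner: "inner (\<pi> a) (\<pi> b) = (if a = b then 1 else 0)" if "a \<in> Basis" "b \<in> Basis" for a b
    using orthonormal_set_inner[OF B(1) \<pi>B[OF that(1)] \<pi>B[OF that(2)]] \<pi> that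
    by (auto simp: bij_betw_def inj_on_def)
  have inner_T: "inner (T x) (\<pi> a) = inner x a" if a: "a \<in> Basis" for x a
  proof -
    have "inner (T x) (\<pi> a) = (\<Sum>b\<in>Basis. if b = a then inner x a else 0)"
      unfolding T_def inner_sum_left by (intro sum.cong) (auto simp: \<pi>_inner[OF _ a])
    then show ?thesis using a by simp
  qed
  have "linear T"
    unfolding T_def by (intro linear_compose_sum ballI linearI) (simp_all add: inner_add_left scaleR_add_left)
  moreover have "inner (T x) (T y) = inner x y" for x y
  proof -
    have "inner (T x) (T y) = (\<Sum>a\<in>Basis. inner y a * inner (T x) (\<pi> a))"
      by (subst (2) T_def) (simp add: inner_sum_right)
    also have "\<dots> = (\<Sum>a\<in>Basis. inner x a * inner y a)"
      by (intro sum.cong) (simp_all add: inner_T mult.commute)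
    also have "\<dots> = inner x y"
      by (rule euclidean_inner[symmetric])
    finally show ?thesis .
  qed
  ultimately show ?thesis
    using that[OF _ \<pi> inner_T] by (simp add: orthogonal_transformation_def)
qed

text \<open>An orthogonal map taking the standard basis to B preserves \<open>lborel\<close> and
  carries boxes in standard coordinates to boxes in B-coordinates. Boxes determine the product
  measure, and in standard coordinates their measure comes from the construction of
  \<open>lborel\<close>.\<close>

lemma lborel_eq_distr_orthonormal:
  fixes B :: "'a::euclidean_space set"
  assumes B: "orthonormal_set B" "span B = UNIV"
  shows "lborel = distr (PiM B (\<lambda>_. lborel)) borel (\<lambda>c. \<Sum>b\<in>B. c b *\<^sub>R b)"
proof -
  have finB: "finite B" using orthonormal_set_finite[OF B(1)] .
  obtain T :: "'a \<Rightarrow> 'a" and \<pi> where T: "orthogonal_transformation T"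
    and \<pi>: "bij_betw \<pi> Basis B" and inner_T: "\<And>x a. a \<in> Basis \<Longrightarrow> inner (T x) (\<pi> a) = inner x a"
    using orthonormal_basis_transformation[OF B] by metis
  have T_meas [measurable]: "T \<in> borel_measurable borel"
    using orthogonal_transformation_linear[OF T]
    by (intro borel_measurable_continuous_onI linear_continuous_on) (simp add: linear_conv_bounded_linear)
  define crd where "crd x = (\<lambda>b\<in>B. inner x b)" for x :: "'a"
  have crd [measurable]: "crd \<in> borel \<rightarrow>\<^sub>M PiM B (\<lambda>_. lborel)"
    unfolding crd_def by (intro measurable_restrict) simp
  have PiM: "distr lborel (PiM B (\<lambda>_. lborel)) crd = PiM B (\<lambda>_. lborel)"
  proof (rule lborel_prod.PiM_eqI[OF finB])
    fix A :: "'a \<Rightarrow> real set" assume A: "\<And>b. b \<in> B \<Longrightarrow> A b \<in> sets lborel"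
    have box_sets: "Pi\<^sub>E B A \<in> sets (PiM B (\<lambda>_. lborel))"
      using A finB by (intro sets_PiM_I_finite) auto
    have S: "crd -` Pi\<^sub>E B A \<in> sets borel"
      using measurable_sets[OF crd box_sets] by simp
    have "emeasure (distr lborel (PiM B (\<lambda>_. lborel)) crd) (Pi\<^sub>E B A) = emeasure lborel (crd -` Pi\<^sub>E B A)"
      using box_sets by (simp add: emeasure_distr)
    also have "\<dots> = emeasure lborel (T -` (crd -` Pi\<^sub>E B A))"
      using S by (subst lborel_distr_orthogonal_transformation[OF T, symmetric]) (simp add: emeasure_distr)
    also have "T -` (crd -` Pi\<^sub>E B A) = {x. \<forall>a\<in>Basis. inner x a \<in> A (\<pi> a)}"
    proof -
      have "crd (T x) \<in> Pi\<^sub>E B A \<longleftrightarrow> (\<forall>a\<in>Basis. inner x a \<in> A (\<pi> a))" for x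
      proof -
        have "crd (T x) \<in> Pi\<^sub>E B A \<longleftrightarrow> (\<forall>b\<in>B. inner (T x) b \<in> A b)"
          by (auto simp: crd_def PiE_iff)
        also have "\<dots> \<longleftrightarrow> (\<forall>a\<in>Basis. inner (T x) (\<pi> a) \<in> A (\<pi> a))"
          using \<pi> by (auto simp: bij_betw_def)
        finally show ?thesis by (simp add: inner_T)
      qed
      then show ?thesis by auto
    qed
    also have "emeasure lborel {x. \<forall>a\<in>Basis. inner x a \<in> A (\<pi> a)} =
        emeasure (PiM Basis (\<lambda>_. lborel)) (Pi\<^sub>E Basis (\<lambda>a. A (\<pi> a)))"
    proof -
      have A\<pi>: "A (\<pi> a) \<in> sets borel" if "a \<in> Basis" for a
        using A[of "\<pi> a"] \<pi> that by (auto simp: bij_betw_def)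
      have set: "{x :: 'a. \<forall>a\<in>Basis. inner x a \<in> A (\<pi> a)} \<in> sets borel"
      proof -
        have "{x \<in> space borel. inner x a \<in> A (\<pi> a)} \<in> sets borel" if "a \<in> Basis" for a :: "'a"
          using measurable_sets_borel[OF _ A\<pi>[OF that], of "\<lambda>x. inner x a"] by (simp add: vimage_def)
        then show ?thesis
          using sets.sets_Collect_finite_All[of Basis borel "\<lambda>a x. inner x a \<in> A (\<pi> a)"] by simp
      qed
      have "(\<lambda>f. \<Sum>a\<in>Basis. f a *\<^sub>R a) -` {x :: 'a. \<forall>a\<in>Basis. inner x a \<in> A (\<pi> a)} \<inter> space (PiM Basis (\<lambda>_. lborel)) =
          Pi\<^sub>E Basis (\<lambda>a. A (\<pi> a))"
        by (auto simp: space_PiM PiE_iff inner_sum_left_Basis)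
      then show ?thesis
        using set by (subst lborel_eq) (simp add: emeasure_distr)
    qed
    also have "\<dots> = (\<Prod>a\<in>Basis. emeasure lborel (A (\<pi> a)))"
      using A \<pi> by (intro lborel_prod.emeasure_PiM) (auto simp: bij_betw_def)
    also have "\<dots> = (\<Prod>b\<in>B. emeasure lborel (A b))"
      by (rule prod.reindex_bij_betw[OF \<pi>])
    finally show "emeasure (distr lborel (PiM B (\<lambda>_. lborel)) crd) (Pi\<^sub>E B A) = (\<Prod>b\<in>B. emeasure lborel (A b))" .
  qed simp
  have sum_meas: "(\<lambda>c. \<Sum>b\<in>B. c b *\<^sub>R b) \<in> PiM B (\<lambda>_. lborel) \<rightarrow>\<^sub>M borel"
  proof (intro borel_measurable_sum borel_measurable_scaleR borel_measurable_const)
    fix b assume "b \<in> B"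
    from measurable_component_singleton[OF this, of "\<lambda>_. lborel"]
    show "(\<lambda>c. c b) \<in> borel_measurable (PiM B (\<lambda>_. lborel))" by simp
  qed
  have "distr (PiM B (\<lambda>_. lborel)) borel (\<lambda>c. \<Sum>b\<in>B. c b *\<^sub>R b) = distr lborel borel ((\<lambda>c. \<Sum>b\<in>B. c b *\<^sub>R b) \<circ> crd)"
    by (subst PiM[symmetric]) (rule distr_distr, use sum_meas in auto)
  also have "(\<lambda>c. \<Sum>b\<in>B. c b *\<^sub>R b) \<circ> crd = (\<lambda>x. x)"
    using orthonormal_expansion[OF B(1)] B(2) by (auto simp: crd_def fun_eq_iff)
  finally show ?thesis
    by (simp add: distr_id2)
qed

section \<open>The main inequality\<close>

text \<open>On a null set containing the exceptional points the value is changed to 0 below and to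
  infinity above. Bounds at every point are essential: a null set can contain whole lines, and a
  supremum or an Asplund sum depends on each single value.\<close>

lemma completion_borel_sandwich:
  fixes f :: "'a \<Rightarrow> ennreal"
  assumes "f \<in> borel_measurable (completion M)"
  obtains lo hi where "lo \<in> borel_measurable M" "hi \<in> borel_measurable M"
    "\<And>x. x \<in> space M \<Longrightarrow> lo x \<le> f x" "\<And>x. x \<in> space M \<Longrightarrow> f x \<le> hi x"
    "(\<integral>\<^sup>+x. lo x \<partial>M) = (\<integral>\<^sup>+x. f x \<partial>completion M)" "(\<integral>\<^sup>+x. hi x \<partial>M) = (\<integral>\<^sup>+x. f x \<partial>completion M)"
proof -
  obtain g where g [measurable]: "g \<in> borel_measurable M" and "AE x in M. f x = g x"
    using completion_ex_borel_measurable[OF assms] by auto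
  then obtain Z where Z: "Z \<in> null_sets M" "{x \<in> space M. f x \<noteq> g x} \<subseteq> Z"
    by (auto simp: eventually_ae_filter)
  have Z_sets [measurable]: "Z \<in> sets M" using Z(1) by auto
  define lo hi where "lo x = (if x \<in> Z then 0 else g x)" and "hi x = (if x \<in> Z then \<infinity> else g x)" for x
  have [measurable]: "lo \<in> borel_measurable M" "hi \<in> borel_measurable M"
    unfolding lo_def hi_def by measurable
  have "AE x in M. x \<notin> Z"
    using Z(1) by (rule AE_not_in)
  then have "AE x in M. lo x = f x" "AE x in M. hi x = f x"
    using AE_space by (eventually_elim, use Z in \<open>auto simp: lo_def hi_def\<close>)+
  then have "(\<integral>\<^sup>+x. lo x \<partial>M) = (\<integral>\<^sup>+x. f x \<partial>M)" "(\<integral>\<^sup>+x. hi x \<partial>M) = (\<integral>\<^sup>+x. f x \<partial>M)"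
    by (auto intro: nn_integral_cong_AE)
  moreover have "lo x \<le> f x" "f x \<le> hi x" if "x \<in> space M" for x
    using Z(2) that by (auto simp: lo_def hi_def)
  ultimately show ?thesis
    using that[of lo hi] by (auto simp: nn_integral_completion)
qed

section \<open>Coordinates adapted to a hyperplane\<close>

locale hyperplane =
  fixes H :: "(real ^ 'n) set"
  assumes subspace_H: "subspace H" and dim_H: "dim H = CARD('n) - 1"
begin

abbreviation "\<nu> \<equiv> unit_normal H"
abbreviation "onb \<equiv> onb_of H"
abbreviation "coord_space \<equiv> PiM onb (\<lambda>_. lborel :: real measure)"

text \<open>Coordinates turn H into a finite product, to which the induction on the index set
  applies. For H = {0} the index set is empty and \<open>embed\<close> is constantly 0.\<close>

definition embed :: "(real ^ 'n \<Rightarrow> real) \<Rightarrow> real ^ 'n" where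
  "embed c = (\<Sum>b\<in>onb. c b *\<^sub>R b)"

lemma unit_normal_props: "norm \<nu> = 1" "\<And>h. h \<in> H \<Longrightarrow> inner h \<nu> = 0"
proof -
  have "dim H < DIM(real ^ 'n)"
    using dim_H by simp
  then obtain z where z: "z \<noteq> 0" "\<And>y. y \<in> span H \<Longrightarrow> orthogonal z y"
    by (rule orthogonal_to_subspace_exists) blast
  have "norm (z /\<^sub>R norm z) = 1 \<and> (\<forall>h\<in>H. inner h (z /\<^sub>R norm z) = 0)"
    using z by (auto simp: orthogonal_def inner_commute span_base)
  then have "norm \<nu> = 1 \<and> (\<forall>h\<in>H. inner h \<nu> = 0)"
    unfolding unit_normal_def by (rule someI)
  then show "norm \<nu> = 1" "\<And>h. h \<in> H \<Longrightarrow> inner h \<nu> = 0" by auto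
qed

lemma onb_props: "orthonormal_set onb" "span onb = H"
proof -
  have "\<exists>B. pairwise orthogonal B \<and> (\<forall>b\<in>B. norm b = 1) \<and> span B = H"
    by (rule orthonormal_basis_subspace[OF subspace_H]) blast
  then have "pairwise orthogonal onb \<and> (\<forall>b\<in>onb. norm b = 1) \<and> span onb = H"
    unfolding onb_of_def by (rule someI_ex)
  then show "orthonormal_set onb" "span onb = H"
    by (auto simp: orthonormal_set_def)
qed

lemma onb_subset: "b \<in> onb \<Longrightarrow> b \<in> H"
  using onb_props(2) span_base by blast

lemma finite_onb: "finite onb"
  using onb_props(1) by (rule orthonormal_set_finite)

lemma unit_normal_notin_onb: "\<nu> \<notin> onb"
  using onb_subset[of \<nu>] unit_normal_props by (auto simp: norm_eq_1)

lemma full_basis: "orthonormal_set (insert \<nu> onb)" "span (insert \<nu> onb) = UNIV"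
proof -
  show 1: "orthonormal_set (insert \<nu> onb)"
    using onb_props(1) unit_normal_props onb_subset
    by (auto simp: orthonormal_set_def pairwise_insert orthogonal_def inner_commute)
  have "card onb = CARD('n) - 1"
    using dim_H onb_props basis_card_eq_dim[of onb H] orthonormal_set_independent[OF onb_props(1)]
      span_superset[of onb] by auto
  then have "card (insert \<nu> onb) = CARD('n)"
    using finite_onb unit_normal_notin_onb by simp
  then have "UNIV \<subseteq> span (insert \<nu> onb)"
    using card_ge_dim_independent[of "insert \<nu> onb" UNIV] orthonormal_set_independent[OF 1]
    by (simp add: dim_UNIV)
  then show "span (insert \<nu> onb) = UNIV" by auto
qed

lemma measurable_embed [measurable]: "embed \<in> borel_measurable coord_space"
  unfolding embed_def
proof (intro borel_measurable_sum borel_measurable_scaleR borel_measurable_const)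
  fix b assume "b \<in> onb"
  from measurable_component_singleton[OF this, of "\<lambda>_. lborel"]
  show "(\<lambda>c. c b) \<in> borel_measurable coord_space" by simp
qed

lemma embed_in_H: "embed c \<in> H"
  unfolding embed_def using onb_subset by (intro subspace_sum[OF subspace_H] subspace_scale[OF subspace_H]) auto

lemma embed_combination:
  "embed (combination onb l c d) = (1 - l) *\<^sub>R embed c + l *\<^sub>R embed d"
  by (simp add: embed_def combination_def scaleR_sum_right sum.distrib[symmetric] scaleR_add_left)

lemma nn_integral_fibres:
  assumes [measurable]: "h \<in> borel_measurable borel"
  shows "(\<integral>\<^sup>+x. h x \<partial>lborel) = (\<integral>\<^sup>+c. \<integral>\<^sup>+\<alpha>. h (embed c + \<alpha> *\<^sub>R \<nu>) \<partial>lborel \<partial>coord_space)"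
proof -
  let ?N = "PiM (insert \<nu> onb) (\<lambda>_. lborel :: real measure)"
  let ?e = "\<lambda>c. \<Sum>b\<in>insert \<nu> onb. c b *\<^sub>R b"
  have e [measurable]: "?e \<in> borel_measurable ?N"
  proof (intro borel_measurable_sum borel_measurable_scaleR borel_measurable_const)
    fix b assume "b \<in> insert \<nu> onb"
    from measurable_component_singleton[OF this, of "\<lambda>_. lborel"]
    show "(\<lambda>c. c b) \<in> borel_measurable ?N" by simp
  qed
  have upd: "?e (c(\<nu> := \<alpha>)) = embed c + \<alpha> *\<^sub>R \<nu>" for c \<alpha>
  proof -
    have "(\<Sum>b\<in>onb. (c(\<nu> := \<alpha>)) b *\<^sub>R b) = embed c"
      unfolding embed_def using unit_normal_notin_onb by (intro sum.cong) auto
    then show ?thesis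
      using finite_onb unit_normal_notin_onb by (simp add: add.commute)
  qed
  have "(\<integral>\<^sup>+x. h x \<partial>lborel) = (\<integral>\<^sup>+x. h x \<partial>distr ?N borel ?e)"
    by (subst lborel_eq_distr_orthonormal[OF full_basis]) (rule refl)
  also have "\<dots> = (\<integral>\<^sup>+c. h (?e c) \<partial>?N)"
    by (rule nn_integral_distr) simp_all
  also have "\<dots> = (\<integral>\<^sup>+c. \<integral>\<^sup>+\<alpha>. h (?e (c(\<nu> := \<alpha>))) \<partial>lborel \<partial>coord_space)"
    by (rule lborel_prod.product_nn_integral_insert[OF finite_onb unit_normal_notin_onb])
       (rule measurable_compose[OF e assms])
  finally show ?thesis
    by (simp only: upd)
qed

text \<open>Coordinates are a measurable bijection with measurable inverse, and completing the
  measure does not change upper integrals: a majorant measurable for the completion lies below a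
  Borel one with the same integral.\<close>

lemma upper_integral_embed:
  "upper_integral (lebesgue_subspace H) F = upper_integral coord_space (\<lambda>c. F (embed c))"
proof -
  define D where "D = distr coord_space (restrict_space borel H) embed"
  have emb [measurable]: "embed \<in> coord_space \<rightarrow>\<^sub>M restrict_space borel H"
    using embed_in_H by (intro measurable_restrict_space2) auto
  have leb: "lebesgue_subspace H = completion D"
    by (simp add: lebesgue_subspace_def D_def embed_def[abs_def])
  have space_D: "space D = H"
    by (simp add: D_def space_restrict_space)
  define crd where "crd x = (\<lambda>b\<in>onb. inner x b)" for x :: "real ^ 'n"
  have crd [measurable]: "crd \<in> D \<rightarrow>\<^sub>M coord_space"
  proof -
    have "crd \<in> borel \<rightarrow>\<^sub>M coord_space"
      unfolding crd_def by (intro measurable_restrict) simp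
    then have "crd \<in> restrict_space borel H \<rightarrow>\<^sub>M coord_space"
      by (rule measurable_restrict_space1)
    then show ?thesis
      unfolding D_def by (simp cong: measurable_cong_sets)
  qed
  have embed_crd: "embed (crd x) = x" if "x \<in> H" for x
  proof -
    have "embed (crd x) = (\<Sum>b\<in>onb. inner x b *\<^sub>R b)"
      unfolding embed_def crd_def by (intro sum.cong) auto
    then show ?thesis
      using orthonormal_expansion[OF onb_props(1), of x] onb_props(2) that by simp
  qed
  have crd_embed: "crd (embed c) = c" if "c \<in> space coord_space" for c
    using that inner_sum_orthonormal[OF onb_props(1)]
    by (auto simp: crd_def embed_def space_PiM PiE_iff extensional_def restrict_def fun_eq_iff)
  have meas_D: "borel_measurable D = (borel_measurable (restrict_space borel H) :: (real ^ 'n \<Rightarrow> ennreal) set)"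
    by (rule measurable_cong_sets) (simp_all add: D_def)
  have int_D: "(\<integral>\<^sup>+x. k x \<partial>D) = (\<integral>\<^sup>+c. k (embed c) \<partial>coord_space)" if "k \<in> borel_measurable D" for k
    using that unfolding D_def by (intro nn_integral_distr emb)
  show ?thesis
  proof (rule antisym)
    show "upper_integral (lebesgue_subspace H) F \<le> upper_integral coord_space (\<lambda>c. F (embed c))"
    proof (rule upper_integral_attained[of coord_space "\<lambda>c. F (embed c)"])
      fix k assume k [measurable]: "k \<in> borel_measurable coord_space"
        and k_le: "\<And>c. c \<in> space coord_space \<Longrightarrow> F (embed c) \<le> k c"
        and k_int: "(\<integral>\<^sup>+c. k c \<partial>coord_space) = upper_integral coord_space (\<lambda>c. F (embed c))"
      have k2: "(\<lambda>x. k (crd x)) \<in> borel_measurable D" by measurable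
      have "upper_integral (completion D) F \<le> (\<integral>\<^sup>+x. k (crd x) \<partial>completion D)"
        unfolding upper_integral_def
      proof (rule INF_lower)
        have "F x \<le> k (crd x)" if "x \<in> H" for x
          using k_le[of "crd x"] embed_crd[OF that] measurable_space[OF crd, of x] that space_D by simp
        then show "(\<lambda>x. k (crd x)) \<in> {k \<in> borel_measurable (completion D). \<forall>x\<in>space (completion D). F x \<le> k x}"
          using k2 by (simp add: space_D measurable_completion)
      qed
      also have "\<dots> = (\<integral>\<^sup>+c. k (crd (embed c)) \<partial>coord_space)"
        using int_D[OF k2] by (simp add: nn_integral_completion)
      also have "\<dots> = (\<integral>\<^sup>+c. k c \<partial>coord_space)"
        by (intro nn_integral_cong) (simp add: crd_embed)
      finally show ?thesis
        by (simp add: leb k_int)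
    qed
    show "upper_integral coord_space (\<lambda>c. F (embed c)) \<le> upper_integral (lebesgue_subspace H) F"
    proof (rule upper_integral_attained[of "completion D" F])
      fix k assume k: "k \<in> borel_measurable (completion D)"
        and k_le: "\<And>x. x \<in> space (completion D) \<Longrightarrow> F x \<le> k x"
        and k_int: "(\<integral>\<^sup>+x. k x \<partial>completion D) = upper_integral (completion D) F"
      show ?thesis
      proof (rule completion_borel_sandwich[OF k])
        fix hi assume hi: "hi \<in> borel_measurable D" "\<And>x. x \<in> space D \<Longrightarrow> k x \<le> hi x"
          "(\<integral>\<^sup>+x. hi x \<partial>D) = (\<integral>\<^sup>+x. k x \<partial>completion D)"
        have hi': "(\<lambda>c. hi (embed c)) \<in> borel_measurable coord_space"
        proof (rule measurable_compose[OF emb])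
          show "hi \<in> borel_measurable (restrict_space borel H)"
            using hi(1) unfolding meas_D .
        qed
        have "upper_integral coord_space (\<lambda>c. F (embed c)) \<le> (\<integral>\<^sup>+c. hi (embed c) \<partial>coord_space)"
          unfolding upper_integral_def
        proof (rule INF_lower)
          have "F x \<le> hi x" if "x \<in> H" for x
            using k_le[of x] hi(2)[of x] that by (simp add: space_D)
          then show "(\<lambda>c. hi (embed c)) \<in> {k \<in> borel_measurable coord_space. \<forall>x\<in>space coord_space. F (embed x) \<le> k x}"
            using hi' embed_in_H by simp
        qed
        also have "\<dots> = upper_integral (completion D) F"
          using int_D[OF hi(1)] hi(3) k_int by simp
        finally show ?thesis by (simp add: leb)
      qed
    qed
  qed
qed

lemma fibre_measurable:
  fixes h :: "real ^ 'n \<Rightarrow> ennreal"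
  assumes [measurable]: "h \<in> borel_measurable borel"
  shows "(\<lambda>\<alpha>. h (x + \<alpha> *\<^sub>R \<nu>)) \<in> borel_measurable borel"
    and "(\<lambda>c. \<integral>\<^sup>+\<alpha>. h (embed c + \<alpha> *\<^sub>R \<nu>) \<partial>lborel) \<in> borel_measurable coord_space"
proof -
  show "(\<lambda>\<alpha>. h (x + \<alpha> *\<^sub>R \<nu>)) \<in> borel_measurable borel" by measurable
  have "(\<lambda>z. h (embed (fst z) + snd z *\<^sub>R \<nu>)) \<in> borel_measurable (coord_space \<Otimes>\<^sub>M lborel)"
  proof (rule measurable_compose[OF _ assms], intro borel_measurable_add borel_measurable_scaleR)
    show "(\<lambda>z. embed (fst z)) \<in> borel_measurable (coord_space \<Otimes>\<^sub>M (lborel :: real measure))"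
      by (rule measurable_compose[OF measurable_fst measurable_embed])
    show "snd \<in> borel_measurable (coord_space \<Otimes>\<^sub>M (lborel :: real measure))"
      using measurable_snd[of coord_space "lborel :: real measure"] by simp
  qed simp
  then show "(\<lambda>c. \<integral>\<^sup>+\<alpha>. h (embed c + \<alpha> *\<^sub>R \<nu>) \<partial>lborel) \<in> borel_measurable coord_space"
    using lborel.borel_measurable_nn_integral[of "\<lambda>c \<alpha>. h (embed c + \<alpha> *\<^sub>R \<nu>)" coord_space]
    by (simp add: case_prod_beta)
qed

end

theorem theorem3p2:
  fixes f g :: "real ^ 'n \<Rightarrow> ennreal"
    and lam :: real
    and H :: "(real ^ 'n) set"
  assumes "0 < lam" and "lam < 1"
    and "\<And>x. f x < \<infinity>" and "\<And>x. g x < \<infinity>"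
    and "f \<in> borel_measurable lebesgue" and "g \<in> borel_measurable lebesgue"
    and "asplund_sum lam f g \<in> borel_measurable lebesgue"
    and "subspace H" and "dim H = CARD('n) - 1"
    and "asplund_sum lam (finite_part (steiner_fun H f)) (finite_part (steiner_fun H g))
           \<in> borel_measurable lebesgue"
    and "asplund_sum lam (schwarz_fun H (finite_part (steiner_fun H f)))
                         (schwarz_fun H (finite_part (steiner_fun H g)))
           \<in> borel_measurable lebesgue"
    and "upper_integral (lebesgue_subspace H) (proj_fun H f)
           = upper_integral (lebesgue_subspace H) (proj_fun H g)"
    and "upper_integral (lebesgue_subspace H) (proj_fun H g) < \<infinity>"
  shows "(\<integral>\<^sup>+ x. asplund_sum lam f g x \<partial>lebesgue)
           \<ge> ennreal (1 - lam) * (\<integral>\<^sup>+ x. f x \<partial>lebesgue) + ennreal lam * (\<integral>\<^sup>+ x. g x \<partial>lebesgue)"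
proof -
  note l = assms(1,2)
  interpret hyperplane H by unfold_locales (fact assms)+
  \<comment> \<open>Minorants for f and g and a majorant for the Asplund sum, all with unchanged
    integrals, so that the fibre inequality applies on every line.\<close>
  obtain f0 where f0 [measurable]: "f0 \<in> borel_measurable borel" and f0_le: "\<And>x. f0 x \<le> f x"
    and f0_int: "(\<integral>\<^sup>+x. f0 x \<partial>lborel) = (\<integral>\<^sup>+x. f x \<partial>lebesgue)"
    by (rule completion_borel_sandwich[OF assms(5)]) auto
  obtain g0 where g0 [measurable]: "g0 \<in> borel_measurable borel" and g0_le: "\<And>x. g0 x \<le> g x"
    and g0_int: "(\<integral>\<^sup>+x. g0 x \<partial>lborel) = (\<integral>\<^sup>+x. g x \<partial>lebesgue)"
    by (rule completion_borel_sandwich[OF assms(6)]) auto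
  obtain m0 where m0 [measurable]: "m0 \<in> borel_measurable borel" and m0_ge: "\<And>x. asplund_sum lam f g x \<le> m0 x"
    and m0_int: "(\<integral>\<^sup>+x. m0 x \<partial>lborel) = (\<integral>\<^sup>+x. asplund_sum lam f g x \<partial>lebesgue)"
    by (rule completion_borel_sandwich[OF assms(7)]) auto
  \<comment> \<open>The projections are those of f and g, not of their minorants, since it is the
    former whose upper integrals are assumed equal. They may be non-measurable.\<close>
  define F G where "F c = proj_fun H f (embed c)" and "G c = proj_fun H g (embed c)" for c
  define P Q M where "P c = (\<integral>\<^sup>+\<alpha>. f0 (embed c + \<alpha> *\<^sub>R \<nu>) \<partial>lborel)"
    and "Q c = (\<integral>\<^sup>+\<alpha>. g0 (embed c + \<alpha> *\<^sub>R \<nu>) \<partial>lborel)"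
    and "M c = (\<integral>\<^sup>+\<alpha>. m0 (embed c + \<alpha> *\<^sub>R \<nu>) \<partial>lborel)" for c
  have meas: "P \<in> borel_measurable coord_space" "Q \<in> borel_measurable coord_space" "M \<in> borel_measurable coord_space"
    unfolding P_def Q_def M_def by (rule fibre_measurable; fact)+
  have ints: "(\<integral>\<^sup>+x. f x \<partial>lebesgue) = (\<integral>\<^sup>+c. P c \<partial>coord_space)"
    "(\<integral>\<^sup>+x. g x \<partial>lebesgue) = (\<integral>\<^sup>+c. Q c \<partial>coord_space)"
    "(\<integral>\<^sup>+x. asplund_sum lam f g x \<partial>lebesgue) = (\<integral>\<^sup>+c. M c \<partial>coord_space)"
    unfolding f0_int[symmetric] g0_int[symmetric] m0_int[symmetric] P_def Q_def M_def
    by (rule nn_integral_fibres; fact)+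
  \<comment> \<open>The quotients P / F and Q / G lose the numerators where the projections vanish;
    on such lines the minorants vanish identically.\<close>
  have zero: "(\<integral>\<^sup>+\<alpha>. k0 (embed c + \<alpha> *\<^sub>R \<nu>) \<partial>lborel) = 0"
    if "proj_fun H k (embed c) = 0" "\<And>x. k0 x \<le> k x" for c and k k0 :: "real ^ 'n \<Rightarrow> ennreal"
  proof -
    have "k0 (embed c + \<alpha> *\<^sub>R \<nu>) = 0" for \<alpha>
    proof -
      have "k0 (embed c + \<alpha> *\<^sub>R \<nu>) \<le> k (embed c + \<alpha> *\<^sub>R \<nu>)" by (rule that)
      also have "\<dots> \<le> proj_fun H k (embed c)"
        unfolding proj_fun_def by (rule SUP_upper) simp
      finally show ?thesis using that(1) by simp
    qed
    then show ?thesis by simp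
  qed
  have P0: "P c = 0" if "F c = 0" for c
    using that unfolding P_def F_def by (rule zero) (rule f0_le)
  have Q0: "Q c = 0" if "G c = 0" for c
    using that unfolding Q_def G_def by (rule zero) (rule g0_le)
  define A where "A = upper_integral coord_space F"
  have A_F: "upper_integral coord_space F = A" and A_G: "upper_integral coord_space G = A" and A_fin: "A < \<infinity>"
    using assms(12,13) unfolding upper_integral_embed A_def F_def G_def by simp_all
  show ?thesis
  proof (cases "A = 0")
    \<comment> \<open>With A = 0 no normalization is possible, but then both projections vanish
      almost everywhere, and f and g have integral 0.\<close>
    case True
    have null: "(\<integral>\<^sup>+c. R c \<partial>coord_space) = 0"
      if "upper_integral coord_space K = 0" "\<And>c. K c = 0 \<Longrightarrow> R c = 0" for K R :: "_ \<Rightarrow> ennreal"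
    proof (rule upper_integral_attained[of coord_space K])
      fix Ks assume Ks: "Ks \<in> borel_measurable coord_space" "\<And>c. c \<in> space coord_space \<Longrightarrow> K c \<le> Ks c"
        "(\<integral>\<^sup>+c. Ks c \<partial>coord_space) = upper_integral coord_space K"
      have "AE c in coord_space. Ks c = 0"
        using Ks(1,3) that(1) by (simp add: nn_integral_0_iff_AE)
      then have "AE c in coord_space. R c = 0"
        using AE_space
      proof eventually_elim
        case (elim c)
        then have "K c = 0" using Ks(2)[of c] by simp
        then show ?case by (rule that(2))
      qed
      then have "(\<integral>\<^sup>+c. R c \<partial>coord_space) = (\<integral>\<^sup>+c. 0 \<partial>coord_space)"
        by (rule nn_integral_cong_AE)
      then show ?thesis by simp
    qed
    show ?thesis
      unfolding ints using null[of F P] null[of G Q] A_F A_G True P0 Q0 by simp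
  next
    case False
    have "ennreal_pow A (1 - lam) * ennreal_pow A lam *
      (ennreal (1 - lam) * ((\<integral>\<^sup>+c. P c \<partial>coord_space) / A) + ennreal lam * ((\<integral>\<^sup>+c. Q c \<partial>coord_space) / A))
      \<le> (\<integral>\<^sup>+c. M c \<partial>coord_space)"
    proof (rule PiM_inequality_upper[OF l finite_onb meas, where F=F and G=G, unfolded A_F A_G])
      fix x y assume x: "0 < F x" "F x < \<infinity>" and y: "0 < G y" "G y < \<infinity>"
      show "ennreal_pow (F x) (1 - lam) * ennreal_pow (G y) lam *
        (ennreal (1 - lam) * (P x / F x) + ennreal lam * (Q y / G y)) \<le> M (combination onb lam x y)"
        unfolding P_def Q_def M_def F_def G_def proj_fun_def
      proof (rule fibre_inequality[OF l])
        fix s t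
        have "ennreal_pow (f (embed x + s *\<^sub>R \<nu>)) (1 - lam) * ennreal_pow (g (embed y + t *\<^sub>R \<nu>)) lam \<le>
            asplund_sum lam f g ((1 - lam) *\<^sub>R (embed x + s *\<^sub>R \<nu>) + lam *\<^sub>R (embed y + t *\<^sub>R \<nu>))"
          unfolding asplund_sum_def by (rule Sup_upper) blast
        also have "\<dots> \<le> m0 ((1 - lam) *\<^sub>R (embed x + s *\<^sub>R \<nu>) + lam *\<^sub>R (embed y + t *\<^sub>R \<nu>))"
          by (rule m0_ge)
        also have "(1 - lam) *\<^sub>R (embed x + s *\<^sub>R \<nu>) + lam *\<^sub>R (embed y + t *\<^sub>R \<nu>) =
            embed (combination onb lam x y) + ((1 - lam) * s + lam * t) *\<^sub>R \<nu>"
          by (simp add: embed_combination scaleR_add_right scaleR_add_left)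
        finally show "ennreal_pow (f (embed x + s *\<^sub>R \<nu>)) (1 - lam) * ennreal_pow (g (embed y + t *\<^sub>R \<nu>)) lam \<le>
            m0 (embed (combination onb lam x y) + ((1 - lam) * s + lam * t) *\<^sub>R \<nu>)" .
      qed (use x y f0_le g0_le fibre_measurable(1) f0 g0 m0 in \<open>auto simp: F_def G_def proj_fun_def\<close>)
    qed (use False A_fin P0 Q0 in \<open>auto simp: zero_less_iff_neq_zero\<close>)
    \<comment> \<open>Here the equality of the two masses enters: the powers combine to A, which
      cancels the denominators of both means.\<close>
    moreover have "ennreal_pow A (1 - lam) * ennreal_pow A lam = A"
    proof -
      obtain a where a: "A = ennreal a" "0 < a"
        using A_fin False by (cases A) (auto simp: zero_less_iff_neq_zero less_le)
      then show ?thesis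
        by (simp add: ennreal_pow_ennreal ennreal_mult[symmetric] powr_add[symmetric])
    qed
    moreover have "A * (c * (X / A)) = c * X" for c X
      using False A_fin by (simp add: ennreal_times_divide mult.left_commute[of A] mult.commute[of A] ennreal_mult_divide_eq)
    ultimately show ?thesis
      unfolding ints by (simp add: distrib_left)
  qed
qed

end
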